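(* Let $0<p,q<\infty$, $0<s\le q$, $\beta_i>-1$ for $i=1,\ldots,m$ and let $\mu$ be a positive Borel measure on $\mathbb H$. Then the following conditions are equivalent. (1) There is a constant $C>0$ such that for all $f_i\in A(s,\beta_i)$, $i=1,\ldots,m$, $$\|(f_1,\ldots,f_m)\|_{A(p,q,m,d\mu)}\le C\prod_{i=1}^m\|f_i\|_{A(s,\beta_i)}.$$ (2) There is a constant $C>0$ such that $$\mu(\Delta_k)\le C\,\eta_k^{\sum_{i=1}^m\frac{p(n+1+\beta_i)}{s}},\qquad k\ge1.$$
   Context: $\mathbb H=\{(x,t):x\in\mathbb R^n,\ t>0\}\subset\mathbb R^{n+1}$; points are written $z=(x,t)$. $h(\mathbb H)$ is the space of harmonic functions on $\mathbb H$. $A\asymp B$ means $cA\le B\le CA$ for some constants $c,C>0$. For $0<p<\infty$, $\lambda>-1$, the weighted harmonic Bergman space $A(p,\lambda)$ consists of all $f\in h(\mathbb H)$ with $\|f\|_{A(p,\lambda)}=\left(\int_{\mathbb H}|f(x,t)|^p t^\lambda\,dx\,dt\right)^{1/p}<\infty$. $\{\Delta_k\}_{k\ge1}$ is a fixed Whitney decomposition of $\mathbb H$: closed cubes in $\mathbb H$ with sides parallel to the coordinate axes, with pairwise disjoint interiors, $\bigcup_k\Delta_k=\mathbb H$, and $\operatorname{diam}\Delta_k\asymp\operatorname{dist}(\Delta_k,\partial\mathbb H)$ uniformly in $k$. $\zeta_k=(\xi_k,\eta_k)$ is the center of $\Delta_k$. $\Delta_k^\ast$ is the cube with the same center as $\Delta_k$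 enlarged $5/4$ times; these satisfy $\Delta_k^\ast\subset\mathbb H$, $\sum_k\chi_{\Delta_k^\ast}\le C_n$, and $t\asymp\eta_k$ for $(x,t)\in\Delta_k^\ast$, uniformly in $k$. For $0<p,q<\infty$, a positive Borel measure $\mu$ on $\mathbb H$ and $f_1,\ldots,f_m\in h(\mathbb H)$, $$\|(f_1,\ldots,f_m)\|_{A(p,q,m,d\mu)}^q=\sum_{k=1}^\infty\left(\int_{\Delta_k}\prod_{i=1}^m|f_i(z)|^p\,d\mu(z)\right)^{q/p}.$$ *)

theory Defs
  imports "HOL-Analysis.Analysis"
begin

text \<open>A point \<open>z = (x, t)\<close> of \<open>\<real>\<^sup>n\<^sup>+\<^sup>1\<close> is a pair in \<open>(real^'n) \<times> real\<close>, so \<open>n = CARD('n)\<close>.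
  The product norm and product \<open>lborel\<close> are the Euclidean norm and Lebesgue measure.\<close>

definition upper_half_space :: "((real^'n) \<times> real) set" where
  "upper_half_space = {z. 0 < snd z}"

definition partial_derivative :: "'a::euclidean_space \<Rightarrow> ('a \<Rightarrow> real) \<Rightarrow> 'a \<Rightarrow> real" where
  "partial_derivative b f z = frechet_derivative f (at z) b"

text \<open>Real-valued \<open>C\<^sup>2\<close> functions with vanishing Laplacian. Values outside \<open>S\<close> are irrelevant.\<close>

definition harmonic_on :: "('a::euclidean_space \<Rightarrow> real) \<Rightarrow> 'a set \<Rightarrow> bool" where
  "harmonic_on f S \<longleftrightarrow>
     open S \<and>
     f differentiable_on S \<and>
     (\<forall>b\<in>Basis. partial_derivative b f differentiable_on S) \<and>
     (\<forall>b\<in>Basis. \<forall>c\<in>Basis. continuous_on S (partial_derivative c (partial_derivative b f))) \<and>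
     (\<forall>z\<in>S. (\<Sum>b\<in>Basis. partial_derivative b (partial_derivative b f) z) = 0)"

text \<open>Real powers on \<open>[0, \<infinity>]\<close>, intended for exponents \<open>a > 0\<close> (so that \<open>\<infinity>\<close> goes to \<open>\<infinity>\<close>
  and \<open>0\<close> goes to \<open>0\<close>).\<close>

definition ennreal_powr :: "ennreal \<Rightarrow> real \<Rightarrow> ennreal" where
  "ennreal_powr x a = (if x = \<infinity> then \<infinity> else ennreal (enn2real x powr a))"

definition bergman_norm :: "real \<Rightarrow> real \<Rightarrow> ((real^'n) \<times> real \<Rightarrow> real) \<Rightarrow> ennreal" where
  "bergman_norm p \<alpha> f =
     ennreal_powr (\<integral>\<^sup>+z\<in>upper_half_space. ennreal (\<bar>f z\<bar> powr p * snd z powr \<alpha>) \<partial>lborel) (1 / p)"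

definition bergman_space :: "real \<Rightarrow> real \<Rightarrow> ((real^'n) \<times> real \<Rightarrow> real) set" where
  "bergman_space p \<alpha> = {f. harmonic_on f upper_half_space \<and> bergman_norm p \<alpha> f < \<infinity>}"

definition closed_cube :: "'a::euclidean_space \<Rightarrow> real \<Rightarrow> 'a set" where
  "closed_cube c l = cbox (c - (l / 2) *\<^sub>R One) (c + (l / 2) *\<^sub>R One)"

text \<open>\<open>\<zeta> k\<close> is the center of \<open>\<Delta> k\<close>. The boundary of the half
  space is taken in \<open>\<real>\<^sup>n\<^sup>+\<^sup>1\<close>, i.e. it is the hyperplane \<open>t = 0\<close>.\<close>

definition whitney_decomposition ::
  "(nat \<Rightarrow> ((real^'n) \<times> real) set) \<Rightarrow> (nat \<Rightarrow> (real^'n) \<times> real) \<Rightarrow> bool" where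
  "whitney_decomposition \<Delta> \<zeta> \<longleftrightarrow>
     (\<exists>l. \<forall>k. 0 < l k \<and> \<Delta> k = closed_cube (\<zeta> k) (l k)) \<and>
     (\<forall>k. \<Delta> k \<subseteq> upper_half_space) \<and>
     (\<forall>j k. j \<noteq> k \<longrightarrow> interior (\<Delta> j) \<inter> interior (\<Delta> k) = {}) \<and>
     (\<Union>k. \<Delta> k) = upper_half_space \<and>
     (\<exists>c>0. \<exists>C>0. \<forall>k.
        c * setdist (\<Delta> k) (frontier upper_half_space) \<le> diameter (\<Delta> k) \<and>
        diameter (\<Delta> k) \<le> C * setdist (\<Delta> k) (frontier upper_half_space))"

text \<open>The functions are \<open>f 1, \<dots>, f m\<close>; the measure \<open>\<mu>\<close> lives on the half space.\<close>

definition mixed_norm ::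
  "(nat \<Rightarrow> ((real^'n) \<times> real) set) \<Rightarrow> real \<Rightarrow> real \<Rightarrow> nat \<Rightarrow> ((real^'n) \<times> real) measure \<Rightarrow>
   (nat \<Rightarrow> (real^'n) \<times> real \<Rightarrow> real) \<Rightarrow> ennreal" where
  "mixed_norm \<Delta> p q m \<mu> f =
     ennreal_powr
       (\<Sum>k. ennreal_powr (\<integral>\<^sup>+z\<in>\<Delta> k. ennreal (\<Prod>i=1..m. \<bar>f i z\<bar> powr p) \<partial>\<mu>) (q / p))
       (1 / q)"

end

theory Submission
  imports Defs
begin

text \<open>
  Sufficiency: for harmonic \<open>f\<close> and every \<open>s > 0\<close>, \<open>\<bar>f z\<bar>\<^sup>s\<close> is at most a constant times the mean of
  \<open>\<bar>f\<bar>\<^sup>s\<close> over a ball around \<open>z\<close>. On a Whitney cube this bounds every \<open>f\<^sub>i\<close> by its integral over an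
  enlarged cube, and since \<open>q / s \<ge> 1\<close> and the enlarged cubes have bounded overlap, the resulting sums
  are controlled by the Bergman norms.

  Necessity: for each cube, test with one rapidly decaying harmonic function, the Kelvin transform of
  a homogeneous harmonic polynomial of large degree, with its pole below the boundary at depth
  comparable to \<open>\<eta>\<^sub>k\<close>. A pole that is deep enough sees the whole cube within a narrow cone, on which
  the function is positive.
\<close>

section \<open>Mean value estimates for harmonic functions\<close>

text \<open>For \<open>s < 1\<close> the power \<open>|f|^s\<close> of a harmonic function need not
  be subharmonic, so its mean value bound cannot come from convexity; a single maximum point
  argument covers all \<open>s > 0\<close>. The assumption \<open>s \<le> q\<close> enters through
  summation: if \<open>a_k\<close> are local integrals, the sum of \<open>a_k^(q/s)\<close> is at
  most a power of the global integral times the sum of the \<open>a_k\<close>. In a product of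
  \<open>m\<close> factors only one has to be summed; the others are bounded by their global norms,
  so no Hoelder inequality is required. For necessity the Newtonian kernel would decay too slowly
  when \<open>s\<close> is small or a weight is large. A polynomial factor of degree
  \<open>J\<close>, before the Kelvin transform, raises the order of decay at the price of sign
  changes, hence the restriction to a cone. One function fills all \<open>m\<close> slots although
  the spaces differ: \<open>J\<close> is taken large enough for every weight, and the order of decay
  enters the norms and the lower bound with the same power of \<open>\<eta> k\<close>, so it drops
  out.\<close>

lemma has_field_derivative_along_line:
  fixes g :: "'a::real_normed_vector \<Rightarrow> real"
  assumes D: "(g has_derivative g') (at (y + h *\<^sub>R b))"
  shows "((\<lambda>h. g (y + h *\<^sub>R b)) has_field_derivative g' b) (at h within U)"
proof -
  have "((\<lambda>h. y + h *\<^sub>R b) has_derivative (\<lambda>x. x *\<^sub>R b)) (at h within U)"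
    by (rule derivative_eq_intros refl | simp)+
  from has_derivative_compose[OF this D]
  have "((\<lambda>h. g (y + h *\<^sub>R b)) has_derivative (\<lambda>x. g' (x *\<^sub>R b))) (at h within U)" .
  moreover have "(\<lambda>x. g' (x *\<^sub>R b)) = (*) (g' b)"
    using linear_cmul[OF has_derivative_linear[OF D]] by (simp add: fun_eq_iff)
  ultimately show ?thesis
    unfolding has_field_derivative_def by simp
qed

lemma mem_centered_cube:
  "y \<in> cbox (- (t *\<^sub>R One)) (t *\<^sub>R One) \<longleftrightarrow> (\<forall>i\<in>Basis. \<bar>y \<bullet> i\<bar> \<le> t)"
  for y :: "'a::euclidean_space"
  by (auto simp: mem_box abs_le_iff)

text \<open>By translation invariance \<open>\<integral> g (y + h b) dy\<close> does not depend on \<open>h\<close>; differentiate it at \<open>h = 0\<close>.\<close>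

lemma integral_partial_derivative_eq_0:
  fixes g :: "'a::euclidean_space \<Rightarrow> real"
  assumes deriv: "\<And>y. y \<in> cbox (- (3 *\<^sub>R One)) (3 *\<^sub>R One) \<Longrightarrow> (g has_derivative g' y) (at y)"
    and cont: "continuous_on (cbox (- (3 *\<^sub>R One)) (3 *\<^sub>R One)) (\<lambda>y. g' y b)"
    and b: "b \<in> Basis"
    and supp: "\<And>y. y \<notin> cbox (- One) One \<Longrightarrow> g y = 0"
  shows "integral (cbox (- (2 *\<^sub>R One)) (2 *\<^sub>R One)) (\<lambda>y. g' y b) = 0"
proof -
  let ?Q = "\<lambda>t::real. cbox (- (t *\<^sub>R One)) (t *\<^sub>R One) :: 'a set"
  define G where "G h = integral (?Q 2) (\<lambda>y. g (y + h *\<^sub>R b))" for h :: real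
  note mem = mem_centered_cube
  \<comment> \<open>The half-sides 1, 2, 3 leave room for shifts with
    \<open>\<bar>h\<bar> \<le> 1\<close>: a moved \<open>?Q 2\<close> stays inside
    \<open>?Q 3\<close>, where the derivative is known, and still covers \<open>?Q 1\<close>,
    outside which \<open>g\<close> vanishes.\<close>
  have shift: "y + h *\<^sub>R b \<in> ?Q 3" if "y \<in> ?Q 2" "h \<in> {-1..1}" for y h
  proof -
    have "\<bar>(y + h *\<^sub>R b) \<bullet> i\<bar> \<le> 3" if "i \<in> Basis" for i
    proof -
      have "\<bar>h * (b \<bullet> i)\<bar> \<le> 1"
        using \<open>h \<in> _\<close> b that by (auto simp: inner_Basis abs_le_iff)
      moreover have "\<bar>y \<bullet> i\<bar> \<le> 2"
        using \<open>y \<in> _\<close> that unfolding mem by auto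
      ultimately show ?thesis
        by (simp add: inner_add_left)
    qed
    then show ?thesis
      unfolding mem by auto
  qed
  have gcont: "continuous_on (?Q 3) g"
    using deriv by (meson continuous_at_imp_continuous_on has_derivative_continuous)
  have "(G has_field_derivative integral (?Q 2) (\<lambda>y. g' (y + 0 *\<^sub>R b) b)) (at 0 within {-1..1})"
    unfolding G_def
  proof (rule leibniz_rule_field_derivative)
    fix h :: real and y assume h: "h \<in> {-1..1}" and y: "y \<in> ?Q 2"
    show "((\<lambda>h. g (y + h *\<^sub>R b)) has_field_derivative g' (y + h *\<^sub>R b) b) (at h within {-1..1})"
      using deriv[OF shift[OF y h]] by (rule has_field_derivative_along_line)
  next
    fix h :: real assume h: "h \<in> {-1..1}"
    show "(\<lambda>y. g (y + h *\<^sub>R b)) integrable_on ?Q 2"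
      by (intro integrable_continuous continuous_on_compose2[OF gcont] continuous_intros)
        (use shift h in auto)
  next
    show "continuous_on ({-1..1} \<times> ?Q 2) (\<lambda>(h, y). g' (y + h *\<^sub>R b) b)"
      unfolding split_beta
      by (intro continuous_on_compose2[OF cont] continuous_intros) (use shift in auto)
  qed auto
  moreover have "G h = integral (?Q 1) g" if h: "h \<in> {-1..1}" for h
  proof -
    have "G h = integral (cbox (- (2 *\<^sub>R One) + h *\<^sub>R b) (2 *\<^sub>R One + h *\<^sub>R b)) g"
      unfolding G_def
      using integral_shift_cbox_plus[of "- (2 *\<^sub>R One)" "2 *\<^sub>R One" g "h *\<^sub>R b"]
      by (simp add: o_def add.commute)
    also have "\<dots> = integral (?Q 1) g"
    proof (rule integral_spike_set)
      let ?B = "cbox (- (2 *\<^sub>R One) + h *\<^sub>R b) (2 *\<^sub>R One + h *\<^sub>R b)"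
      have sub: "?Q 1 \<subseteq> ?B"
      proof
        fix y assume y: "y \<in> ?Q 1"
        have "(- (2 *\<^sub>R One) + h *\<^sub>R b) \<bullet> i \<le> y \<bullet> i \<and> y \<bullet> i \<le> (2 *\<^sub>R One + h *\<^sub>R b) \<bullet> i"
          if i: "i \<in> Basis" for i
        proof -
          have "\<bar>h * (b \<bullet> i)\<bar> \<le> 1"
            using h b i by (auto simp: inner_Basis abs_le_iff)
          moreover have "\<bar>y \<bullet> i\<bar> \<le> 1"
            using y i unfolding mem by auto
          ultimately show ?thesis
            using i by (auto simp: inner_add_left inner_diff_left abs_le_iff)
        qed
        then show "y \<in> ?B"
          by (simp add: mem_box)
      qed
      then have eq: "{x \<in> ?Q 1 - ?B. g x \<noteq> 0} = {}"
        by auto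
      show "negligible {x \<in> ?Q 1 - ?B. g x \<noteq> 0}"
        unfolding eq by simp
      have eq: "{x \<in> ?B - ?Q 1. g x \<noteq> 0} = {}"
        using supp by auto
      show "negligible {x \<in> ?B - ?Q 1. g x \<noteq> 0}"
        unfolding eq by simp
    qed
    finally show ?thesis .
  qed
  then have "(G has_field_derivative 0) (at 0 within {-1..1})"
    by (intro has_field_derivative_transform_within[OF DERIV_const zero_less_one]) simp_all
  ultimately show ?thesis
    by (simp add: at_within_Icc_at DERIV_unique)
qed

text \<open>This weight is chosen because \<open>y * bump y\<close> is, up to a factor, the gradient of \<open>(bump y)\<^sup>2\<close>. So an
  integration by parts turns the radial derivative of the weighted mean into an integral of the
  Laplacian, and no surface integrals are needed.\<close>

definition bump :: "'a::euclidean_space \<Rightarrow> real" where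
  "bump y = max 0 (1 - y \<bullet> y)"

lemma bump_nonneg: "0 \<le> bump y" and bump_le_1: "bump y \<le> 1"
  by (auto simp: bump_def)

lemma bump_eq_0: "norm y > 1 \<Longrightarrow> bump y = 0"
  by (auto simp: bump_def norm_eq_sqrt_inner)

lemma continuous_on_bump: "continuous_on S bump"
  unfolding bump_def by (intro continuous_intros)

text \<open>\<open>bump\<close> has a kink on the unit sphere, and squaring removes it: at
  \<open>u = 0\<close> the difference quotient is \<open>max 0 h\<close>, which tends to 0.\<close>

lemma pos_part_square_has_derivative:
  "((\<lambda>u::real. (max 0 u)\<^sup>2) has_field_derivative 2 * max 0 u) (at u)"
proof -
  consider "u < 0" | "u = 0" | "0 < u" by linarith
  then show ?thesis
  proof cases
    case 1
    then have "((\<lambda>u::real. (max 0 u)\<^sup>2) has_field_derivative 0) (at u)"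
      by (intro has_field_derivative_transform_within_open[OF DERIV_const, where S = "{..<0}"]) simp_all
    then show ?thesis using 1 by simp
  next
    case 3
    have "((\<lambda>u. u\<^sup>2) has_field_derivative 2 * u) (at u)"
      by (rule derivative_eq_intros refl | simp)+
    then have "((\<lambda>u::real. (max 0 u)\<^sup>2) has_field_derivative 2 * u) (at u)"
      by (rule has_field_derivative_transform_within_open[where S = "{0<..}"]) (use 3 in simp_all)
    then show ?thesis using 3 by simp
  next
    case 2
    have "((\<lambda>h::real. max 0 h) \<longlongrightarrow> max 0 0) (at 0)"
      by (intro tendsto_intros)
    moreover have "(max 0 h)\<^sup>2 / h = max 0 h" for h :: real
      by (cases "h > 0") (simp_all add: power2_eq_square)
    ultimately have "((\<lambda>h::real. (max 0 h)\<^sup>2 / h) \<longlongrightarrow> 0) (at 0)"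
      by simp
    then show ?thesis
      using 2 by (simp add: DERIV_def)
  qed
qed

lemma bump_square_has_derivative:
  fixes y :: "'a::euclidean_space"
  shows "((\<lambda>y. (bump y)\<^sup>2) has_derivative (\<lambda>v. - 4 * (y \<bullet> v) * bump y)) (at y)"
proof -
  have "((\<lambda>y. 1 - y \<bullet> y) has_derivative (\<lambda>v. - 2 * (y \<bullet> v))) (at y)"
    by (rule derivative_eq_intros refl | simp add: inner_commute)+
  from has_derivative_compose[OF this pos_part_square_has_derivative[unfolded has_field_derivative_def]]
  show ?thesis
    unfolding bump_def by (simp add: mult_ac)
qed

lemma harmonic_onD:
  assumes "harmonic_on f S" and z: "z \<in> S"
  shows "(f has_derivative frechet_derivative f (at z)) (at z)"
    and "b \<in> Basis \<Longrightarrow> (partial_derivative b f has_derivative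
           frechet_derivative (partial_derivative b f) (at z)) (at z)"
    and "(\<Sum>b\<in>Basis. partial_derivative b (partial_derivative b f) z) = 0"
proof -
  have "open S"
    using assms unfolding harmonic_on_def by auto
  then have *: "g differentiable at z" if "g differentiable_on S" for g :: "'a \<Rightarrow> real"
    using that z by (metis at_within_open differentiable_on_def)
  show "(f has_derivative frechet_derivative f (at z)) (at z)"
    using assms * unfolding harmonic_on_def by (auto simp: frechet_derivative_works)
  show "b \<in> Basis \<Longrightarrow> (partial_derivative b f has_derivative
           frechet_derivative (partial_derivative b f) (at z)) (at z)"
    using assms * unfolding harmonic_on_def by (auto simp: frechet_derivative_works)
  show "(\<Sum>b\<in>Basis. partial_derivative b (partial_derivative b f) z) = 0"
    using assms unfolding harmonic_on_def by auto
qed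

lemma harmonic_on_continuous:
  assumes "harmonic_on f S"
  shows "continuous_on S f" and "b \<in> Basis \<Longrightarrow> continuous_on S (partial_derivative b f)"
  using assms unfolding harmonic_on_def by (auto intro: differentiable_imp_continuous_on)

lemma frechet_derivative_eq_partial_derivative:
  assumes "harmonic_on f S" "z \<in> S"
  shows "frechet_derivative f (at z) v = (\<Sum>b\<in>Basis. (v \<bullet> b) * partial_derivative b f z)"
proof -
  have lin: "linear (frechet_derivative f (at z))"
    using harmonic_onD(1)[OF assms] by (rule has_derivative_linear)
  have "frechet_derivative f (at z) v = frechet_derivative f (at z) (\<Sum>b\<in>Basis. (v \<bullet> b) *\<^sub>R b)"
    by (simp add: euclidean_representation)
  then show ?thesis
    by (simp add: linear_sum[OF lin] linear_cmul[OF lin] partial_derivative_def)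
qed

text \<open>Divergence theorem for the compactly supported field whose component along
  \<open>b\<close> is \<open>partial_derivative b f\<close> at \<open>z + r y\<close>, times the
  square of \<open>bump y\<close>. Its divergence in \<open>y\<close> is -4 times the integrand plus
  \<open>r\<close> times the squared bump times the Laplacian of \<open>f\<close>, and the latter
  vanishes. The integral is the derivative, in the radius, of the mean studied in
  \<open>weighted_mean_value\<close>.\<close>

lemma weighted_integral_radial_derivative_eq_0:
  fixes f :: "'a::euclidean_space \<Rightarrow> real"
  assumes f: "harmonic_on f S"
    and sub: "\<And>y. y \<in> cbox (- (3 *\<^sub>R One)) (3 *\<^sub>R One) \<Longrightarrow> z + r *\<^sub>R y \<in> S"
  shows "integral (cbox (- (2 *\<^sub>R One)) (2 *\<^sub>R One))
           (\<lambda>y. bump y * (\<Sum>b\<in>Basis. (y \<bullet> b) * partial_derivative b f (z + r *\<^sub>R y))) = 0"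
proof -
  let ?Q = "\<lambda>t::real. cbox (- (t *\<^sub>R One)) (t *\<^sub>R One) :: 'a set"
  let ?D = "\<lambda>b. partial_derivative b f"
  let ?DD = "\<lambda>b c. partial_derivative c (partial_derivative b f)"
  define g' where "g' b y v = ?D b (z + r *\<^sub>R y) * (- 4 * (y \<bullet> v) * bump y) +
      frechet_derivative (?D b) (at (z + r *\<^sub>R y)) (r *\<^sub>R v) * (bump y)\<^sup>2" for b y v
  have g'_eq: "g' b y b = - 4 * (bump y * ((y \<bullet> b) * ?D b (z + r *\<^sub>R y))) + r * ?DD b b (z + r *\<^sub>R y) * (bump y)\<^sup>2"
    if b: "b \<in> Basis" and y: "y \<in> ?Q 3" for b y
  proof -
    have "linear (frechet_derivative (?D b) (at (z + r *\<^sub>R y)))"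
      using harmonic_onD(2)[OF f sub[OF y] b] by (rule has_derivative_linear)
    then show ?thesis
      unfolding g'_def by (simp add: linear_cmul partial_derivative_def)
  qed
  have Q3: "?Q 2 \<subseteq> ?Q 3"
    unfolding subset_iff mem_centered_cube by force
  have cont1: "continuous_on (?Q 3) (\<lambda>y. ?D b (z + r *\<^sub>R y))" if "b \<in> Basis" for b
    by (intro continuous_on_compose2[OF harmonic_on_continuous(2)[OF f that]] continuous_intros)
      (use sub in auto)
  have DDc: "continuous_on S (?DD b b)" if "b \<in> Basis" for b
    using f that unfolding harmonic_on_def by auto
  have cont2: "continuous_on (?Q 3) (\<lambda>y. ?DD b b (z + r *\<^sub>R y))" if "b \<in> Basis" for b
    by (intro continuous_on_compose2[OF DDc[OF that]] continuous_intros)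
      (use sub in auto)
  have cont: "continuous_on (?Q 3) (\<lambda>y. g' b y b)" if b: "b \<in> Basis" for b
  proof (subst continuous_on_cong[OF refl g'_eq[OF b]])
    show "continuous_on (?Q 3) (\<lambda>y. - 4 * (bump y * ((y \<bullet> b) * ?D b (z + r *\<^sub>R y)))
        + r * ?DD b b (z + r *\<^sub>R y) * (bump y)\<^sup>2)"
      by (intro continuous_intros cont1[OF b] cont2[OF b] continuous_on_bump)
  qed
  have zero: "integral (?Q 2) (\<lambda>y. g' b y b) = 0" if b: "b \<in> Basis" for b
  proof (rule integral_partial_derivative_eq_0[where g' = "g' b" and b = b and
        g = "\<lambda>y. ?D b (z + r *\<^sub>R y) * (bump y)\<^sup>2"])
    fix y :: 'a assume y: "y \<in> ?Q 3"
    have "((\<lambda>y. z + r *\<^sub>R y) has_derivative (\<lambda>v. r *\<^sub>R v)) (at y)"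
      by (rule derivative_eq_intros refl | simp)+
    from has_derivative_compose[OF this harmonic_onD(2)[OF f sub[OF y] b]]
    have "((\<lambda>y. ?D b (z + r *\<^sub>R y)) has_derivative
        (\<lambda>v. frechet_derivative (?D b) (at (z + r *\<^sub>R y)) (r *\<^sub>R v))) (at y)" .
    from has_derivative_mult[OF this bump_square_has_derivative]
    show "((\<lambda>y. ?D b (z + r *\<^sub>R y) * (bump y)\<^sup>2) has_derivative g' b y) (at y)"
      unfolding g'_def .
  next
    fix y :: 'a assume "y \<notin> cbox (- One) One"
    then obtain i where i: "i \<in> Basis" "\<bar>y \<bullet> i\<bar> > 1"
      using mem_centered_cube[of y 1] by (auto simp: not_le)
    have "norm y > 1"
      using Basis_le_norm[OF i(1), of y] i(2) by linarith
    then show "?D b (z + r *\<^sub>R y) * (bump y)\<^sup>2 = 0"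
      by (simp add: bump_eq_0)
  qed (use b cont in auto)
  have int: "(\<lambda>y. g' b y b) integrable_on ?Q 2" if "b \<in> Basis" for b
    using cont[OF that] Q3 by (intro integrable_continuous) (rule continuous_on_subset)
  have "0 = integral (?Q 2) (\<lambda>y. \<Sum>b\<in>Basis. g' b y b)"
    using zero int by (simp add: integral_sum)
  also have "\<dots> = integral (?Q 2) (\<lambda>y. - 4 * (bump y * (\<Sum>b\<in>Basis. (y \<bullet> b) * ?D b (z + r *\<^sub>R y))))"
  proof (rule integral_cong)
    fix y assume "y \<in> ?Q 2"
    then have y: "y \<in> ?Q 3" using Q3 by auto
    have "(\<Sum>b\<in>Basis. g' b y b) = - 4 * (bump y * (\<Sum>b\<in>Basis. (y \<bullet> b) * ?D b (z + r *\<^sub>R y)))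
       + r * (bump y)\<^sup>2 * (\<Sum>b\<in>Basis. ?DD b b (z + r *\<^sub>R y))"
      using g'_eq[OF _ y] by (simp add: sum.distrib sum_distrib_left mult_ac sum_subtractf sum_negf)
    then show "(\<Sum>b\<in>Basis. g' b y b) = - 4 * (bump y * (\<Sum>b\<in>Basis. (y \<bullet> b) * ?D b (z + r *\<^sub>R y)))"
      using harmonic_onD(3)[OF f sub[OF y]] by simp
  qed
  also have "\<dots> = - 4 * integral (?Q 2) (\<lambda>y. bump y * (\<Sum>b\<in>Basis. (y \<bullet> b) * ?D b (z + r *\<^sub>R y)))"
    by (rule integral_mult_right)
  finally show ?thesis by simp
qed

text \<open>With the domain fixed and only the argument \<open>z + t y\<close> scaled, the mean can
  be differentiated in \<open>t\<close> under the integral sign. The derivative is zero by the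
  preceding lemma, and at \<open>t = 0\<close> the mean is the right-hand side.\<close>

lemma weighted_mean_value:
  fixes f :: "'a::euclidean_space \<Rightarrow> real"
  assumes f: "harmonic_on f S" and r: "0 \<le> r"
    and sub: "\<And>t y. t \<in> {0..r} \<Longrightarrow> y \<in> cbox (- (3 *\<^sub>R One)) (3 *\<^sub>R One) \<Longrightarrow> z + t *\<^sub>R y \<in> S"
  shows "integral (cbox (- (2 *\<^sub>R One)) (2 *\<^sub>R One)) (\<lambda>y. bump y * f (z + r *\<^sub>R y)) =
         f z * integral (cbox (- (2 *\<^sub>R One)) (2 *\<^sub>R One)) (bump :: 'a \<Rightarrow> real)"
proof -
  let ?Q = "\<lambda>t::real. cbox (- (t *\<^sub>R One)) (t *\<^sub>R One) :: 'a set"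
  let ?D = "\<lambda>b. partial_derivative b f"
  define M where "M t = integral (?Q 2) (\<lambda>y. bump y * f (z + t *\<^sub>R y))" for t
  have Q3: "?Q 2 \<subseteq> ?Q 3"
    unfolding subset_iff mem_centered_cube by force
  have fc: "continuous_on S f" and Dc: "\<And>b. b \<in> Basis \<Longrightarrow> continuous_on S (?D b)"
    using harmonic_on_continuous[OF f] by auto
  have sub2: "z + t *\<^sub>R y \<in> S" if "t \<in> {0..r}" "y \<in> ?Q 2" for t y
    using sub that Q3 by blast
  have "(M has_field_derivative 0) (at t within {0..r})" if t: "t \<in> {0..r}" for t
  proof -
    have "(M has_field_derivative integral (?Q 2)
        (\<lambda>y. bump y * (\<Sum>b\<in>Basis. (y \<bullet> b) * ?D b (z + t *\<^sub>R y)))) (at t within {0..r})"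
      unfolding M_def
    proof (rule leibniz_rule_field_derivative)
      fix t y assume t: "t \<in> {0..r}" and y: "y \<in> ?Q 2"
      have "((\<lambda>t. f (z + t *\<^sub>R y)) has_field_derivative frechet_derivative f (at (z + t *\<^sub>R y)) y)
          (at t within {0..r})"
        by (rule has_field_derivative_along_line[OF harmonic_onD(1)[OF f sub2[OF t y]]])
      from DERIV_cmult[OF this, of "bump y"]
      show "((\<lambda>t. bump y * f (z + t *\<^sub>R y)) has_field_derivative
          bump y * (\<Sum>b\<in>Basis. (y \<bullet> b) * ?D b (z + t *\<^sub>R y))) (at t within {0..r})"
        unfolding frechet_derivative_eq_partial_derivative[OF f sub2[OF t y]] .
    next
      fix t assume t: "t \<in> {0..r}"
      show "(\<lambda>y. bump y * f (z + t *\<^sub>R y)) integrable_on ?Q 2"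
        by (intro integrable_continuous continuous_on_mult continuous_on_bump
            continuous_on_compose2[OF fc] continuous_intros) (use sub2[OF t] in auto)
    next
      show "continuous_on ({0..r} \<times> ?Q 2)
         (\<lambda>(t, y). bump y * (\<Sum>b\<in>Basis. (y \<bullet> b) * ?D b (z + t *\<^sub>R y)))"
        unfolding split_beta
        by (intro continuous_on_mult continuous_on_sum continuous_on_compose2[OF continuous_on_bump[of UNIV]]
            continuous_on_compose2[OF Dc] continuous_intros) (use sub2 in auto)
    qed (use t in auto)
    then show ?thesis
      using weighted_integral_radial_derivative_eq_0[OF f sub[OF t]] by simp
  qed
  then obtain c where c: "\<And>t. t \<in> {0..r} \<Longrightarrow> M t = c"
    using has_field_derivative_zero_constant[of "{0..r}" M] by auto
  have "M r = M 0"
    using c[of r] c[of 0] r by simp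
  then show ?thesis
    unfolding M_def by (simp add: mult.commute)
qed

lemma integral_bump_pos: "0 < integral (cbox (- (2 *\<^sub>R One)) (2 *\<^sub>R One)) (bump :: 'a::euclidean_space \<Rightarrow> real)"
proof -
  let ?Q = "cbox (- (2 *\<^sub>R One)) (2 *\<^sub>R One) :: 'a set"
  have 0: "(0::'a) \<in> ?Q"
    unfolding mem_centered_cube by simp
  have "box (- (2 *\<^sub>R One)) (2 *\<^sub>R One :: 'a) \<noteq> {}"
    by (simp add: box_ne_empty)
  then have "integral ?Q bump = 0 \<longleftrightarrow> (\<forall>y\<in>?Q. bump y = 0)"
    by (intro integral_cbox_eq_0_iff continuous_on_bump) (auto simp: bump_nonneg)
  moreover have "bump (0::'a) = 1"
    by (simp add: bump_def)
  ultimately have "integral ?Q bump \<noteq> 0"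
    using 0 by force
  moreover have "0 \<le> integral ?Q bump"
    by (rule integral_nonneg) (auto intro!: integrable_continuous continuous_on_bump bump_nonneg)
  ultimately show ?thesis by linarith
qed

section \<open>Mean value inequalities over balls, for \<open>f\<close> and for its powers\<close>

lemma nn_integral_lborel_affine:
  fixes g :: "'a::euclidean_space \<Rightarrow> ennreal"
  assumes g: "g \<in> borel_measurable borel" and c: "c \<noteq> 0"
  shows "(\<integral>\<^sup>+x. g x \<partial>lborel) = ennreal (\<bar>c\<bar> ^ DIM('a)) * (\<integral>\<^sup>+x. g (t + c *\<^sub>R x) \<partial>lborel)"
proof -
  have "(\<integral>\<^sup>+x. g x \<partial>lborel) =
      (\<integral>\<^sup>+x. g x \<partial>density (distr lborel borel (\<lambda>x. t + c *\<^sub>R x)) (\<lambda>_. ennreal (\<bar>c\<bar> ^ DIM('a))))"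
    using arg_cong[OF lborel_affine[OF c, of t], of "\<lambda>M. \<integral>\<^sup>+x. g x \<partial>M"] by (simp add: ennreal_power)
  also have "\<dots> = (\<integral>\<^sup>+x. ennreal (\<bar>c\<bar> ^ DIM('a)) * g x \<partial>distr lborel borel (\<lambda>x. t + c *\<^sub>R x))"
    by (rule nn_integral_density) (use g in auto)
  also have "\<dots> = (\<integral>\<^sup>+x. ennreal (\<bar>c\<bar> ^ DIM('a)) * g (t + c *\<^sub>R x) \<partial>lborel)"
    by (rule nn_integral_distr) (use g in measurable)
  also have "\<dots> = ennreal (\<bar>c\<bar> ^ DIM('a)) * (\<integral>\<^sup>+x. g (t + c *\<^sub>R x) \<partial>lborel)"
    by (rule nn_integral_cmult) (use g in measurable)
  finally show ?thesis .
qed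

text \<open>A harmonic function is unconstrained outside its open set, so measurability can only be
  expected of integrands cut off by an indicator.\<close>

lemma borel_measurable_ennreal_indicator:
  fixes h :: "'a::topological_space \<Rightarrow> real"
  assumes "continuous_on A h" "A \<in> sets borel"
  shows "(\<lambda>x. ennreal (h x) * indicator A x) \<in> borel_measurable borel"
proof -
  have "(\<lambda>x. indicator A x *\<^sub>R h x) \<in> borel_measurable borel"
    using assms by (intro borel_measurable_continuous_on_indicator)
  then have "(\<lambda>x. ennreal (indicator A x *\<^sub>R h x)) \<in> borel_measurable borel"
    by measurable
  also have "(\<lambda>x. ennreal (indicator A x *\<^sub>R h x)) = (\<lambda>x. ennreal (h x) * indicator A x)"
    by (auto simp: fun_eq_iff indicator_def)
  finally show ?thesis .
qed

lemma one_le_norm_One: "1 \<le> norm (One :: 'a::euclidean_space)"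
proof -
  obtain b :: 'a where b: "b \<in> Basis"
    using nonempty_Basis by blast
  have "norm b \<le> norm (One::'a)"
    by (rule norm_le_componentwise) (use b in \<open>simp add: inner_Basis\<close>)
  then show ?thesis
    using b by simp
qed

lemma harmonic_mean_bound:
  "\<exists>C>0. \<forall>f S (z::'a::euclidean_space) r. harmonic_on f S \<longrightarrow> 0 < r \<longrightarrow> cball z r \<subseteq> S \<longrightarrow>
     ennreal \<bar>f z\<bar> \<le> ennreal (C / r ^ DIM('a)) * (\<integral>\<^sup>+y\<in>cball z r. ennreal \<bar>f y\<bar> \<partial>lborel)"
proof -
  let ?Q = "\<lambda>t::real. cbox (- (t *\<^sub>R One)) (t *\<^sub>R One) :: 'a set"
  define c where "c = integral (?Q 2) bump"
  \<comment> \<open>Every point of \<open>?Q 3\<close> has norm at most \<open>k\<close>, so with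
    \<open>\<rho> = r / k\<close> all the points \<open>z + \<rho> y\<close> used by the mean value
    property lie in \<open>cball z r\<close>. The factor \<open>k ^ DIM('a)\<close> of the constant
    is the price of integrating at scale \<open>\<rho>\<close> instead of \<open>r\<close>.\<close>
  define k where "k = 3 * norm (One::'a)"
  have c: "c > 0" unfolding c_def by (rule integral_bump_pos)
  note One1 = one_le_norm_One[where 'a = 'a]
  then have k: "k > 0" by (simp add: k_def)
  show ?thesis
  proof (intro exI[of _ "k ^ DIM('a) / c"] conjI allI impI)
    show "0 < k ^ DIM('a) / c" using c k by simp
    fix f S and z :: 'a and r :: real
    assume f: "harmonic_on f S" and r: "0 < r" and sub: "cball z r \<subseteq> S"
    define \<rho> where "\<rho> = r / k"
    have \<rho>: "\<rho> > 0" using r k by (simp add: \<rho>_def)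
    have "\<rho> \<le> r"
      unfolding \<rho>_def using r One1 by (simp add: k_def field_simps)
    have Q3: "z + t *\<^sub>R y \<in> cball z r" if "t \<in> {0..\<rho>}" "y \<in> ?Q 3" for t y
    proof -
      have "norm y \<le> norm (3 *\<^sub>R One :: 'a)"
        using that(2) unfolding mem_centered_cube by (intro norm_le_componentwise) auto
      then have "norm y \<le> k" by (simp add: k_def)
      then have "t * norm y \<le> \<rho> * k"
        using that \<rho> by (intro mult_mono) auto
      then show ?thesis
        using that k by (simp add: dist_norm \<rho>_def)
    qed
    have Q2: "?Q 2 \<subseteq> ?Q 3"
      unfolding subset_iff mem_centered_cube by force
    define g where "g x = ennreal \<bar>f x\<bar> * indicator (cball z r) x" for x
    have fc: "continuous_on (cball z r) f"
      using harmonic_on_continuous(1)[OF f] sub by (rule continuous_on_subset)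
    have gm: "g \<in> borel_measurable borel"
      unfolding g_def by (intro borel_measurable_ennreal_indicator continuous_intros fc) auto
    have cont: "continuous_on (?Q 2) (\<lambda>y. bump y * f (z + \<rho> *\<^sub>R y))"
      by (intro continuous_on_mult continuous_on_bump
            continuous_on_compose2[OF fc] continuous_intros) (use Q3[of \<rho>] \<rho> Q2 in auto)
    have "z + t *\<^sub>R y \<in> S" if "t \<in> {0..\<rho>}" "y \<in> ?Q 3" for t y
      using Q3[OF that] sub by blast
    then have "integral (?Q 2) (\<lambda>y. bump y * f (z + \<rho> *\<^sub>R y)) = f z * c"
      unfolding c_def using \<rho> by (intro weighted_mean_value[OF f]) auto
    then have "\<bar>f z\<bar> * c = \<bar>integral (?Q 2) (\<lambda>y. bump y * f (z + \<rho> *\<^sub>R y))\<bar>"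
      using c by (simp add: abs_mult)
    also have "\<dots> \<le> integral (?Q 2) (\<lambda>y. \<bar>bump y * f (z + \<rho> *\<^sub>R y)\<bar>)"
      unfolding real_norm_def[symmetric]
      by (intro integral_norm_bound_integral integrable_continuous continuous_on_norm cont order_refl)
    finally have "ennreal (\<bar>f z\<bar> * c) \<le> ennreal (integral (?Q 2) (\<lambda>y. \<bar>bump y * f (z + \<rho> *\<^sub>R y)\<bar>))"
      by (rule ennreal_leI)
    also have "\<dots> = (\<integral>\<^sup>+y. ennreal \<bar>bump y * f (z + \<rho> *\<^sub>R y)\<bar> * indicator (?Q 2) y \<partial>lborel)"
      by (intro nn_integral_has_integral_lebesgue'[symmetric] integrable_integral integrable_continuous
          continuous_on_rabs cont) auto
    also have "\<dots> \<le> (\<integral>\<^sup>+y. g (z + \<rho> *\<^sub>R y) \<partial>lborel)"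
    proof (rule nn_integral_mono)
      fix y :: 'a
      show "ennreal \<bar>bump y * f (z + \<rho> *\<^sub>R y)\<bar> * indicator (?Q 2) y \<le> g (z + \<rho> *\<^sub>R y)"
      proof (cases "norm y \<le> 1")
        case True
        then have "\<rho> * norm y \<le> r * 1"
          using \<open>\<rho> \<le> r\<close> \<rho> r by (intro mult_mono) auto
        then have "z + \<rho> *\<^sub>R y \<in> cball z r"
          using \<rho> by (simp add: dist_norm)
        moreover have "\<bar>bump y * f (z + \<rho> *\<^sub>R y)\<bar> \<le> \<bar>f (z + \<rho> *\<^sub>R y)\<bar>"
          using bump_nonneg[of y] bump_le_1[of y] by (simp add: abs_mult mult_left_le_one_le)
        ultimately show ?thesis
          by (auto simp: g_def indicator_def intro!: ennreal_leI)
      next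
        case False
        then show ?thesis by (simp add: bump_eq_0)
      qed
    qed
    finally have *: "ennreal (\<bar>f z\<bar> * c) \<le> (\<integral>\<^sup>+y. g (z + \<rho> *\<^sub>R y) \<partial>lborel)" .
    have "ennreal \<bar>f z\<bar> = ennreal (1 / c) * ennreal (\<bar>f z\<bar> * c)"
      using c by (simp add: ennreal_mult[symmetric])
    also have "\<dots> \<le> ennreal (1 / c) * (\<integral>\<^sup>+y. g (z + \<rho> *\<^sub>R y) \<partial>lborel)"
      by (intro mult_left_mono *) auto
    also have "\<dots> = ennreal (k ^ DIM('a) / c / r ^ DIM('a)) * (ennreal (\<bar>\<rho>\<bar> ^ DIM('a)) * (\<integral>\<^sup>+y. g (z + \<rho> *\<^sub>R y) \<partial>lborel))"
      using c k r \<rho> by (simp add: mult.assoc[symmetric] ennreal_mult[symmetric])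
        (simp add: \<rho>_def power_divide)
    also have "\<dots> = ennreal (k ^ DIM('a) / c / r ^ DIM('a)) * (\<integral>\<^sup>+y. g y \<partial>lborel)"
      using \<rho> by (subst nn_integral_lborel_affine[OF gm, of \<rho> z]) auto
    finally show "ennreal \<bar>f z\<bar> \<le> ennreal (k ^ DIM('a) / c / r ^ DIM('a)) * (\<integral>\<^sup>+y\<in>cball z r. ennreal \<bar>f y\<bar> \<partial>lborel)"
      unfolding g_def .
  qed
qed

text \<open>Values below \<open>\<epsilon> * F\<close> are absorbed by the first term. Otherwise
  \<open>u = x / F\<close> lies between \<open>\<epsilon>\<close> and \<open>B\<close>, and
  \<open>x\<close> equals \<open>u powr (1 - s)\<close> times
  \<open>F powr (1 - s) * x powr s\<close>. The first factor is monotone in \<open>u\<close>,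
  increasing for \<open>s \<le> 1\<close> and decreasing for \<open>s > 1\<close>, so its value at
  one of the two endpoints bounds it.\<close>

lemma powr_interpolation:
  fixes x F s \<epsilon> B K :: real
  assumes F: "0 < F" and x: "0 \<le> x" "x \<le> B * F" and \<epsilon>: "0 < \<epsilon>"
    and K: "\<epsilon> powr (1 - s) \<le> K" "B powr (1 - s) \<le> K"
  shows "x \<le> \<epsilon> * F + K * F powr (1 - s) * x powr s"
proof (cases "x \<le> \<epsilon> * F")
  case True
  have "0 \<le> K" using K(1) powr_ge_zero order_trans by blast
  then show ?thesis using True by (simp add: add_increasing2)
next
  case False
  define u where "u = x / F"
  have u: "\<epsilon> \<le> u" "u \<le> B" "0 < u"
    using False F x \<epsilon> by (auto simp: u_def field_simps)
      (smt (verit) mult_pos_pos)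
  have xu: "x = u * F" using F by (simp add: u_def)
  have "u powr (1 - s) \<le> K"
  proof (cases "s \<le> 1")
    case True
    then have "u powr (1 - s) \<le> B powr (1 - s)" using u by (intro powr_mono2) auto
    then show ?thesis using K by simp
  next
    case False
    then have "u powr (1 - s) \<le> \<epsilon> powr (1 - s)" using u \<epsilon> by (intro powr_mono2') auto
    then show ?thesis using K by simp
  qed
  have "x = (u powr (1 - s) * u powr s) * (F powr (1 - s) * F powr s)"
    unfolding xu powr_add[symmetric] using u F by simp
  also have "\<dots> = u powr (1 - s) * (F powr (1 - s) * x powr s)"
    unfolding xu using u F by (simp add: powr_mult)
  also have "\<dots> \<le> K * (F powr (1 - s) * x powr s)"
    by (intro mult_right_mono \<open>u powr (1 - s) \<le> K\<close>) auto
  also have "\<dots> \<le> \<epsilon> * F + K * F powr (1 - s) * x powr s"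
    using F \<epsilon> by simp
  finally show ?thesis .
qed

text \<open>Let \<open>w\<close> maximise \<open>\<bar>f w\<bar> * dist(w, boundary)\<^sup>\<alpha>\<close> over the ball, with \<open>\<alpha> = N / s\<close>. Near \<open>w\<close> the
  function \<open>f\<close> is at most a multiple of \<open>\<bar>f w\<bar>\<close>, which lets the mean of \<open>\<bar>f\<bar>\<close> be traded for that of \<open>\<bar>f\<bar>\<^sup>s\<close>.\<close>

lemma harmonic_power_mean_bound:
  fixes s :: real
  assumes s: "0 < s"
  shows "\<exists>C>0. \<forall>f S (z::'a::euclidean_space) r. harmonic_on f S \<longrightarrow> 0 < r \<longrightarrow> cball z r \<subseteq> S \<longrightarrow>
     ennreal (\<bar>f z\<bar> powr s) \<le>
       ennreal (C / r ^ DIM('a)) * (\<integral>\<^sup>+y\<in>cball z r. ennreal (\<bar>f y\<bar> powr s) \<partial>lborel)"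
proof -
  let ?N = "DIM('a)"
  obtain C1 where C1: "C1 > 0" and mean: "\<And>f S (z::'a) r. harmonic_on f S \<Longrightarrow> 0 < r \<Longrightarrow> cball z r \<subseteq> S \<Longrightarrow>
     ennreal \<bar>f z\<bar> \<le> ennreal (C1 / r ^ ?N) * (\<integral>\<^sup>+y\<in>cball z r. ennreal \<bar>f y\<bar> \<partial>lborel)"
    using harmonic_mean_bound[where 'a = 'a] by blast
  \<comment> \<open>With this exponent \<open>(t powr \<alpha>) powr s = t ^ DIM('a)\<close>, so the
    weight at the maximum point scales like a volume.\<close>
  define \<alpha> where "\<alpha> = real ?N / s"
  have \<alpha>: "\<alpha> > 0" using s by (simp add: \<alpha>_def)
  define V where "V = unit_ball_vol (real ?N)"
  have V: "V > 0" by (simp add: V_def)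
  \<comment> \<open>\<open>V\<close> is the volume of the unit ball. This value makes the
    \<open>\<epsilon> * F\<close> part of the mean bound on \<open>cball w \<delta>\<close>
    contribute exactly \<open>F / 2\<close>, which is then moved to the left-hand side.\<close>
  define \<epsilon> where "\<epsilon> = 1 / (2 * C1 * V)"
  have \<epsilon>: "\<epsilon> > 0" using C1 V by (simp add: \<epsilon>_def)
  \<comment> \<open>On \<open>cball w \<delta>\<close> the distance \<open>d\<close> drops by at
    most a factor 2 from \<open>d w\<close>, so maximality at \<open>w\<close> gives
    \<open>\<bar>f y\<bar> \<le> B * F\<close> there.\<close>
  define B where "B = 2 powr \<alpha>"
  define K where "K = max (\<epsilon> powr (1 - s)) (B powr (1 - s))"
  have K: "K > 0" using \<epsilon> by (simp add: K_def less_max_iff_disj)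
  \<comment> \<open>One factor 2 comes from absorbing \<open>F / 2\<close>, the power of 2 from the
    radius \<open>\<delta> = d w / 2\<close>.\<close>
  define C where "C = 2 * C1 * K * 2 ^ ?N"
  show ?thesis
  proof (intro exI[of _ C] conjI allI impI)
    show "C > 0" using C1 K by (simp add: C_def)
    fix f S and z :: 'a and r :: real
    assume f: "harmonic_on f S" and r: "0 < r" and sub: "cball z r \<subseteq> S"
    define I where "I = (\<integral>\<^sup>+y\<in>cball z r. ennreal (\<bar>f y\<bar> powr s) \<partial>lborel)"
    have fc: "continuous_on (cball z r) f"
      using harmonic_on_continuous(1)[OF f] sub by (rule continuous_on_subset)
    define d where "d w = r - dist z w" for w
    have d_nonneg: "d w \<ge> 0" if "w \<in> cball z r" for w
      using that by (simp add: d_def)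
    have "continuous_on (cball z r) d"
      unfolding d_def by (intro continuous_intros)
    then have "continuous_on (cball z r) (\<lambda>w. \<bar>f w\<bar> * d w powr \<alpha>)"
      using \<alpha> d_nonneg fc by (intro continuous_on_mult continuous_on_powr' continuous_intros) auto
    moreover have "cball z r \<noteq> {}" using r by simp
    ultimately obtain w where w: "w \<in> cball z r"
      and wmax: "\<And>y. y \<in> cball z r \<Longrightarrow> \<bar>f y\<bar> * d y powr \<alpha> \<le> \<bar>f w\<bar> * d w powr \<alpha>"
      using continuous_attains_sup[OF compact_cball] by blast
    have zmax: "\<bar>f z\<bar> * r powr \<alpha> \<le> \<bar>f w\<bar> * d w powr \<alpha>"
      using wmax[of z] r by (simp add: d_def)
    show "ennreal (\<bar>f z\<bar> powr s) \<le>
       ennreal (C / r ^ ?N) * (\<integral>\<^sup>+y\<in>cball z r. ennreal (\<bar>f y\<bar> powr s) \<partial>lborel)"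
    \<comment> \<open>An infinite \<open>I\<close> makes the claim trivial. If \<open>f z\<close> is
      nonzero, maximality forces \<open>f w\<close> and \<open>d w\<close> to be nonzero, so it is
      safe to divide by both.\<close>
    proof (cases "f z = 0 \<or> I = \<infinity>")
      case True
      then show ?thesis
        using \<open>C > 0\<close> r unfolding I_def by (auto simp: ennreal_mult_top)
    next
      case False
      then obtain i where i: "I = ennreal i" "0 \<le> i"
        by (cases I) auto
      have "0 < \<bar>f z\<bar> * r powr \<alpha>"
        using False r by simp
      then have pos: "0 < \<bar>f w\<bar> * d w powr \<alpha>"
        using zmax by linarith
      define F where "F = \<bar>f w\<bar>"
      have F: "F > 0" using pos by (auto simp: F_def zero_less_mult_iff)
      have dw: "d w > 0" using pos d_nonneg[OF w] by (auto simp: zero_less_mult_iff)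
      define \<delta> where "\<delta> = d w / 2"
      have \<delta>: "\<delta> > 0" using dw by (simp add: \<delta>_def)
      have ball: "y \<in> cball z r" "\<delta> \<le> d y" if "y \<in> cball w \<delta>" for y
      proof -
        have 1: "dist w y \<le> \<delta>" and 2: "r = dist z w + 2 * \<delta>"
          using that by (simp_all add: \<delta>_def d_def field_simps)
        have "dist z y \<le> dist z w + \<delta>"
          using 1 dist_triangle[of z y w] by linarith
        with 2 \<delta> show "y \<in> cball z r" "\<delta> \<le> d y"
          by (simp_all add: d_def)
      qed
      have fB: "\<bar>f y\<bar> \<le> B * F" if y: "y \<in> cball w \<delta>" for y
      proof -
        have "\<bar>f y\<bar> * \<delta> powr \<alpha> \<le> \<bar>f y\<bar> * d y powr \<alpha>"
          using ball[OF y] \<delta> \<alpha> by (intro mult_left_mono powr_mono2) auto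
        also have "\<dots> \<le> F * d w powr \<alpha>"
          using wmax[OF ball(1)[OF y]] by (simp add: F_def)
        also have "d w powr \<alpha> = B * \<delta> powr \<alpha>"
          using dw by (simp add: \<delta>_def B_def powr_divide)
        finally show ?thesis using \<delta> by (simp add: mult.commute)
      qed
      define L where "L = K * F powr (1 - s)"
      have L: "L > 0" using K F by (simp add: L_def)
      have "ennreal F \<le> ennreal (C1 / \<delta> ^ ?N) * (\<integral>\<^sup>+y\<in>cball w \<delta>. ennreal \<bar>f y\<bar> \<partial>lborel)"
        unfolding F_def by (rule mean[OF f \<delta>]) (use ball(1) sub in blast)
      also have "(\<integral>\<^sup>+y\<in>cball w \<delta>. ennreal \<bar>f y\<bar> \<partial>lborel) \<le>
          (\<integral>\<^sup>+y. ennreal (\<epsilon> * F) * indicator (cball w \<delta>) y +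
               ennreal L * (ennreal (\<bar>f y\<bar> powr s) * indicator (cball z r) y) \<partial>lborel)"
      proof (rule nn_integral_mono)
        fix y :: 'a
        have "\<bar>f y\<bar> \<le> \<epsilon> * F + L * \<bar>f y\<bar> powr s" if "y \<in> cball w \<delta>"
          unfolding L_def by (rule powr_interpolation[OF F _ fB[OF that] \<epsilon>]) (auto simp: K_def)
        then have "ennreal \<bar>f y\<bar> \<le> ennreal (\<epsilon> * F) + ennreal L * ennreal (\<bar>f y\<bar> powr s)" if "y \<in> cball w \<delta>"
          using that F \<epsilon> L by (simp add: ennreal_mult[symmetric] ennreal_plus[symmetric] del: ennreal_plus)
        then show "ennreal \<bar>f y\<bar> * indicator (cball w \<delta>) y \<le> ennreal (\<epsilon> * F) * indicator (cball w \<delta>) y +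
               ennreal L * (ennreal (\<bar>f y\<bar> powr s) * indicator (cball z r) y)"
          using ball(1)[of y] by (cases "y \<in> cball w \<delta>") auto
      qed
      also have "\<dots> = ennreal (\<epsilon> * F) * emeasure lborel (cball w \<delta>) + ennreal L * I"
      proof -
        have m: "(\<lambda>y. ennreal (\<bar>f y\<bar> powr s) * indicator (cball z r) y) \<in> borel_measurable borel"
          using s by (intro borel_measurable_ennreal_indicator continuous_on_powr' continuous_intros fc) auto
        then have "(\<integral>\<^sup>+y. ennreal (\<epsilon> * F) * indicator (cball w \<delta>) y +
               ennreal L * (ennreal (\<bar>f y\<bar> powr s) * indicator (cball z r) y) \<partial>lborel) =
            (\<integral>\<^sup>+y. ennreal (\<epsilon> * F) * indicator (cball w \<delta>) y \<partial>lborel) +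
            (\<integral>\<^sup>+y. ennreal L * (ennreal (\<bar>f y\<bar> powr s) * indicator (cball z r) y) \<partial>lborel)"
          using m by (intro nn_integral_add) (auto intro!: borel_measurable_times_ennreal borel_measurable_indicator)
        also have "(\<integral>\<^sup>+y. ennreal L * (ennreal (\<bar>f y\<bar> powr s) * indicator (cball z r) y) \<partial>lborel) = ennreal L * I"
          unfolding I_def using m by (intro nn_integral_cmult) auto
        also have "(\<integral>\<^sup>+y. ennreal (\<epsilon> * F) * indicator (cball w \<delta>) y \<partial>lborel) =
            ennreal (\<epsilon> * F) * emeasure lborel (cball w \<delta>)"
          by (intro nn_integral_cmult_indicator) auto
        finally show ?thesis .
      qed
      also have "\<dots> = ennreal (\<epsilon> * F * (V * \<delta> ^ ?N) + L * i)"
        using \<delta> \<epsilon> F V L i by (simp add: emeasure_cball V_def[symmetric] ennreal_mult[symmetric])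
      also have "ennreal (C1 / \<delta> ^ ?N) * \<dots> = ennreal (C1 / \<delta> ^ ?N * (\<epsilon> * F * (V * \<delta> ^ ?N) + L * i))"
        using C1 \<delta> \<epsilon> F V L i by (intro ennreal_mult[symmetric]) auto
      finally have "ennreal F \<le> ennreal (C1 / \<delta> ^ ?N * (\<epsilon> * F * (V * \<delta> ^ ?N) + L * i))"
        by (simp add: mult_left_mono)
      moreover have "0 \<le> C1 / \<delta> ^ ?N * (\<epsilon> * F * (V * \<delta> ^ ?N) + L * i)"
        using C1 \<delta> \<epsilon> F V L i by simp
      ultimately have "F \<le> C1 / \<delta> ^ ?N * (\<epsilon> * F * (V * \<delta> ^ ?N) + L * i)"
        using ennreal_le_iff by blast
      also have "\<dots> = F / 2 + C1 * L * i / \<delta> ^ ?N"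
        using C1 \<delta> V by (simp add: field_simps \<epsilon>_def)
      finally have "F \<le> 2 * C1 * L * i / \<delta> ^ ?N"
        by linarith
      also have "\<dots> = C * F powr (1 - s) * i / d w ^ ?N"
        using dw by (simp add: C_def L_def \<delta>_def power_divide field_simps)
      finally have "F * F powr (s - 1) \<le> C * F powr (1 - s) * i / d w ^ ?N * F powr (s - 1)"
        by (intro mult_right_mono) auto
      also have "\<dots> = C * i / d w ^ ?N * (F powr (1 - s) * F powr (s - 1))"
        by simp
      also have "\<dots> = C * i / d w ^ ?N"
        using F by (simp add: powr_add[symmetric])
      also have "F * F powr (s - 1) = F powr s"
        using F by (simp add: powr_mult_base)
      finally have Fs: "F powr s * d w ^ ?N \<le> C * i"
        using dw by (simp add: field_simps)
      have pw: "(t powr \<alpha>) powr s = t ^ ?N" if "t > 0" for t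
        using that s by (simp add: powr_powr \<alpha>_def powr_realpow)
      \<comment> \<open>Since \<open>d z = r\<close>, maximality carries the estimate at
        \<open>w\<close> back to the center.\<close>
      have "\<bar>f z\<bar> powr s * r ^ ?N = (\<bar>f z\<bar> * r powr \<alpha>) powr s"
        using r by (simp add: powr_mult pw)
      also have "\<dots> \<le> (F * d w powr \<alpha>) powr s"
        using zmax s r by (intro powr_mono2) (auto simp: F_def)
      also have "\<dots> = F powr s * d w ^ ?N"
        using dw F by (simp add: powr_mult pw)
      also note Fs
      finally have "\<bar>f z\<bar> powr s \<le> C / r ^ ?N * i"
        using r by (simp add: field_simps)
      then have "ennreal (\<bar>f z\<bar> powr s) \<le> ennreal (C / r ^ ?N) * I"
        unfolding i using i(2) \<open>C > 0\<close> r by (subst ennreal_mult[symmetric]) (auto intro!: ennreal_leI)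
      then show ?thesis unfolding I_def .
    qed
  qed
qed

section \<open>Test functions\<close>

lemma harmonic_onI:
  fixes f :: "'a::euclidean_space \<Rightarrow> real"
  assumes S: "open S"
    and D: "\<And>z. z \<in> S \<Longrightarrow> (f has_derivative f' z) (at z)"
    and DD: "\<And>z b. z \<in> S \<Longrightarrow> b \<in> Basis \<Longrightarrow> ((\<lambda>z. f' z b) has_derivative f'' b z) (at z)"
    and cont: "\<And>b c. b \<in> Basis \<Longrightarrow> c \<in> Basis \<Longrightarrow> continuous_on S (\<lambda>z. f'' b z c)"
    and lap: "\<And>z. z \<in> S \<Longrightarrow> (\<Sum>b\<in>Basis. f'' b z b) = 0"
  shows "harmonic_on f S"
proof -
  have p1: "partial_derivative b f z = f' z b" if "z \<in> S" for b z
    using frechet_derivative_at[OF D[OF that]] by (simp add: partial_derivative_def)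
  have D2: "(partial_derivative b f has_derivative f'' b z) (at z)" if "z \<in> S" "b \<in> Basis" for b z
    by (rule has_derivative_transform_within_open[OF DD[OF that] S that(1)]) (simp add: p1)
  have p2: "partial_derivative c (partial_derivative b f) z = f'' b z c" if "z \<in> S" "b \<in> Basis" for b c z
    using frechet_derivative_at[OF D2[OF that]] unfolding partial_derivative_def by simp
  show ?thesis
    unfolding harmonic_on_def
  proof (intro conjI ballI)
    show "f differentiable_on S"
      using D by (meson differentiable_at_imp_differentiable_on differentiableI)
    show "partial_derivative b f differentiable_on S" if "b \<in> Basis" for b
      using D2 that by (meson differentiable_at_imp_differentiable_on differentiableI)
    show "continuous_on S (partial_derivative c (partial_derivative b f))"
      if "b \<in> Basis" "c \<in> Basis" for b c
      using cont[OF that] by (rule continuous_on_eq) (simp add: p2 that)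
    show "(\<Sum>b\<in>Basis. partial_derivative b (partial_derivative b f) z) = 0" if "z \<in> S" for z
      using lap[OF that] p2[OF that] by simp
  qed (rule S)
qed

section \<open>Kelvin transforms of planar harmonic polynomials\<close>

definition planar :: "'a::euclidean_space \<Rightarrow> 'a \<Rightarrow> 'a \<Rightarrow> complex" where
  "planar e e' z = Complex (z \<bullet> e) (z \<bullet> e')"

text \<open>The Kelvin transform of the harmonic polynomial \<open>Re (planar e e' z ^ J)\<close>.\<close>

definition kelvin :: "'a::euclidean_space \<Rightarrow> 'a \<Rightarrow> nat \<Rightarrow> 'a \<Rightarrow> real" where
  "kelvin e e' J z = Re (planar e e' z ^ J) * (z \<bullet> z) powr (- ((real DIM('a) - 2) / 2 + real J))"

lemma bounded_linear_planar: "bounded_linear (planar e e')"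
proof -
  have "linear (planar e e')"
    by (rule linearI) (simp_all add: planar_def complex_eq_iff inner_add_left)
  then show ?thesis
    by (simp add: linear_conv_bounded_linear)
qed

lemmas planar_has_derivative = bounded_linear.has_derivative[OF bounded_linear_planar]

text \<open>The free factor \<open>a\<close> closes the family under differentiation: the derivative
  along \<open>h\<close> is \<open>J\<close> times the member with exponent \<open>J - 1\<close> and
  factor \<open>planar e e' h * a\<close>. The same rule therefore also yields the second
  derivatives.\<close>

lemma planar_power_has_derivative:
  "((\<lambda>z. Re (planar e e' (z + v) ^ J * a)) has_derivative
    (\<lambda>h. real J * Re (planar e e' (z + v) ^ (J - 1) * planar e e' h * a))) (at z)"
proof -
  have "((\<lambda>z. z + v) has_derivative (\<lambda>h. h)) (at z)"
    by (rule derivative_eq_intros refl | simp)+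
  note d = has_derivative_mult_left[OF has_derivative_power[OF planar_has_derivative[OF this, of e e'], of J], of a]
  from bounded_linear.has_derivative[OF bounded_linear_Re d]
  moreover have "Re (a * (of_nat J * x)) = real J * Re (a * x)" for x
    by (simp add: algebra_simps)
  ultimately show ?thesis
    by (simp add: mult_ac del: times_complex.sel)
qed

lemma norm_power_has_derivative:
  fixes z v :: "'a::euclidean_space"
  assumes "z + v \<noteq> 0"
  shows "((\<lambda>z. ((z + v) \<bullet> (z + v)) powr c) has_derivative
    (\<lambda>h. 2 * c * ((z + v) \<bullet> h) * ((z + v) \<bullet> (z + v)) powr (c - 1))) (at z)"
proof -
  have pos: "(z + v) \<bullet> (z + v) > 0" using assms by simp
  have 1: "((\<lambda>z. (z + v) \<bullet> (z + v)) has_derivative (\<lambda>h. 2 * ((z + v) \<bullet> h))) (at z)"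
    by (rule derivative_eq_intros refl | simp add: inner_commute)+
  have "((\<lambda>u. u powr c) has_derivative (*) (c * ((z + v) \<bullet> (z + v)) powr (c - 1))) (at ((z + v) \<bullet> (z + v)))"
    using has_real_derivative_powr[OF pos, of c] by (simp add: has_field_derivative_def)
  from has_derivative_compose[OF 1 this] show ?thesis
    by (simp add: mult_ac)
qed

text \<open>The only nonzero squares are 1 at \<open>e\<close> and -1 at \<open>e'\<close>. Their
  cancellation makes the real part of every power of \<open>planar e e'\<close> harmonic.\<close>

lemma sum_Basis_planar_square:
  assumes "e \<in> Basis" "e' \<in> Basis" "e \<noteq> e'"
  shows "(\<Sum>b\<in>Basis. planar e e' b * planar e e' b) = 0"
proof -
  have "planar e e' b * planar e e' b = of_real (if b = e then 1 else 0) - of_real (if b = e' then 1 else 0)"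
    if "b \<in> Basis" for b
    using that assms by (auto simp: planar_def inner_Basis complex_eq_iff)
  then have "(\<Sum>b\<in>Basis. planar e e' b * planar e e' b) =
      (\<Sum>b\<in>Basis. of_real (if b = e then 1 else 0)) - (\<Sum>b\<in>Basis. of_real (if b = e' then 1 else 0))"
    by (simp add: sum_subtractf)
  also have "\<dots> = 0"
    using assms by (simp add: of_real_sum[symmetric] del: of_real_sum)
  finally show ?thesis .
qed

lemma sum_Basis_planar: "(\<Sum>b\<in>Basis. (w \<bullet> b) *\<^sub>R planar e e' b) = planar e e' w"
  using bounded_linear.linear[OF bounded_linear_planar, of e e']
  by (metis (no_types, lifting) euclidean_representation linear_cmul linear_sum sum.cong)

lemma sum_Basis_inner_square: "(\<Sum>b\<in>Basis. (w \<bullet> b) * (w \<bullet> b)) = w \<bullet> w"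
  by (rule euclidean_inner[symmetric])

text \<open>Let \<open>P\<close> be the polynomial, of degree \<open>J\<close>, and
  \<open>\<rho>\<close> the squared norm, in dimension \<open>N\<close>. The product rule, Euler's
  identity and harmonicity of \<open>P\<close> give the Laplacian of
  \<open>P * \<rho> powr c\<close> as \<open>2 * c * P * \<rho> powr (c - 1)\<close> times
  \<open>2 * (c - 1) + N + 2 * J\<close>. The exponent \<open>c\<close> in \<open>kelvin\<close> is
  the one that annihilates the last factor. The shift by \<open>v\<close> puts the pole at
  \<open>- v\<close>.\<close>

lemma harmonic_on_kelvin:
  fixes v :: "'a::euclidean_space"
  assumes e: "e \<in> Basis" "e' \<in> Basis" "e \<noteq> e'"
    and S: "open S" and nz: "\<And>z. z \<in> S \<Longrightarrow> z + v \<noteq> 0"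
  shows "harmonic_on (\<lambda>z. kelvin e e' J (z + v)) S"
proof -
  let ?w = "planar e e'"
  define c where "c = - ((real DIM('a) - 2) / 2 + real J)"
  define q where "q u z = ((z + v) \<bullet> (z + v)) powr u" for u z
  define R where "R n a z = Re (?w (z + v) ^ n * a)" for n a z
  have dR: "(R n a has_derivative (\<lambda>h. real n * R (n - 1) (?w h * a) z)) (at z)" for n a z
    unfolding R_def using planar_power_has_derivative[of e e' v n a z] by (simp add: mult.assoc)
  have dq: "(q u has_derivative (\<lambda>h. 2 * u * ((z + v) \<bullet> h) * q (u - 1) z)) (at z)" if "z \<in> S" for u z
    unfolding q_def by (rule norm_power_has_derivative[OF nz[OF that]])
  have di: "((\<lambda>z. (z + v) \<bullet> b) has_derivative (\<lambda>h. h \<bullet> b)) (at z)" for b z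
    by (rule derivative_eq_intros refl | simp)+
  have cR: "continuous_on S (R n a)" for n a
    using dR by (meson continuous_at_imp_continuous_on has_derivative_continuous)
  have cq: "continuous_on S (q u)" for u
    using dq by (meson continuous_at_imp_continuous_on has_derivative_continuous)
  define f' where "f' z h = R J 1 z * (2 * c * ((z + v) \<bullet> h) * q (c - 1) z) + real J * R (J - 1) (?w h) z * q c z" for z h
  define f'' where "f'' b z h =
      R J 1 z * (2 * c * (((z + v) \<bullet> b) * (2 * (c - 1) * ((z + v) \<bullet> h) * q (c - 1 - 1) z) + (h \<bullet> b) * q (c - 1) z))
      + real J * R (J - 1) (?w h) z * (2 * c * (((z + v) \<bullet> b) * q (c - 1) z))
      + (real J * R (J - 1) (?w b) z * (2 * c * ((z + v) \<bullet> h) * q (c - 1) z)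
      + real J * (real (J - 1) * R (J - 1 - 1) (?w h * ?w b) z) * q c z)" for b z h
  show ?thesis
  proof (rule harmonic_onI[OF S])
    fix z assume z: "z \<in> S"
    show "((\<lambda>z. kelvin e e' J (z + v)) has_derivative f' z) (at z)"
      using has_derivative_mult[OF dR[of J 1 z] dq[OF z, of c]]
      unfolding f'_def kelvin_def by (simp add: R_def q_def c_def)
    show "((\<lambda>z. f' z b) has_derivative f'' b z) (at z)" if "b \<in> Basis" for b
      unfolding f'_def f''_def
      using has_derivative_add[OF
          has_derivative_mult[OF dR[of J 1 z] has_derivative_mult_right[OF has_derivative_mult[OF di[of b z] dq[OF z, of "c - 1"]], of "2 * c"]]
          has_derivative_mult[OF has_derivative_mult_right[OF dR[of "J - 1" "?w b" z], of "real J"] dq[OF z, of c]]]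
      by (simp add: mult.assoc)
    have nz0: "(z + v) \<bullet> (z + v) > 0" using nz[OF z] by simp
    have q1: "((z + v) \<bullet> (z + v)) * q (c - 1 - 1) z = q (c - 1) z"
      unfolding q_def using nz0 by (simp add: powr_mult_base)
    \<comment> \<open>Together with \<open>s2\<close> this is Euler's identity for the homogeneous
      polynomial. The factor \<open>real J\<close> in \<open>s2\<close> settles
      \<open>J = 0\<close>, where the truncated \<open>J - 1\<close> is 0 as well.\<close>
    have s1: "(\<Sum>b\<in>Basis. ((z + v) \<bullet> b) * R (J - 1) (?w b) z) = R (J - 1) (?w (z + v)) z"
    proof -
      have "(\<Sum>b\<in>Basis. ((z + v) \<bullet> b) * R (J - 1) (?w b) z) =
          R (J - 1) (\<Sum>b\<in>Basis. ((z + v) \<bullet> b) *\<^sub>R ?w b) z"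
        unfolding R_def by (simp only: sum_distrib_left Re_sum mult_scaleR_right scaleR_complex.simps)
      then show ?thesis by (simp add: sum_Basis_planar)
    qed
    have s2: "real J * R (J - 1) (?w (z + v)) z = real J * R J 1 z"
      unfolding R_def by (cases J) (simp_all add: mult.commute)
    \<comment> \<open>The second derivatives of the polynomial itself sum to zero.\<close>
    have s3: "(\<Sum>b\<in>Basis. R (J - 1 - 1) (?w b * ?w b) z) = 0"
    proof -
      have "(\<Sum>b\<in>Basis. R (J - 1 - 1) (?w b * ?w b) z) = R (J - 1 - 1) (\<Sum>b\<in>Basis. ?w b * ?w b) z"
        unfolding R_def by (simp only: sum_distrib_left Re_sum)
      then show ?thesis using sum_Basis_planar_square[OF e] by (simp add: R_def)
    qed
    have "(\<Sum>b\<in>Basis. f'' b z b) =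
        (\<Sum>b\<in>Basis. R J 1 z * 2 * c * 2 * (c - 1) * q (c - 1 - 1) z * (((z + v) \<bullet> b) * ((z + v) \<bullet> b)) +
           R J 1 z * 2 * c * q (c - 1) z +
           4 * c * q (c - 1) z * real J * (((z + v) \<bullet> b) * R (J - 1) (?w b) z) +
           real J * real (J - 1) * q c z * R (J - 1 - 1) (?w b * ?w b) z)"
      by (rule sum.cong) (simp_all add: f''_def algebra_simps)
    also have "\<dots> = R J 1 z * 2 * c * 2 * (c - 1) * q (c - 1 - 1) z * ((z + v) \<bullet> (z + v)) +
           real DIM('a) * (R J 1 z * 2 * c * q (c - 1) z) +
           4 * c * q (c - 1) z * (real J * R (J - 1) (?w (z + v)) z)"
      by (simp only: sum.distrib sum_distrib_left[symmetric] s1 s3 sum_Basis_inner_square sum_constant) simp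
    also have "\<dots> = 2 * c * R J 1 z * (2 * (c - 1) * (((z + v) \<bullet> (z + v)) * q (c - 1 - 1) z)
        + real DIM('a) * q (c - 1) z + 2 * real J * q (c - 1) z)"
      unfolding s2 by (simp add: algebra_simps)
    also have "\<dots> = 2 * c * R J 1 z * q (c - 1) z * (2 * (c - 1) + real DIM('a) + 2 * real J)"
      unfolding q1 by (simp add: algebra_simps)
    also have "2 * (c - 1) + real DIM('a) + 2 * real J = 0"
      by (simp add: c_def field_simps)
    finally show "(\<Sum>b\<in>Basis. f'' b z b) = 0" by simp
  next
    fix b b' :: 'a
    show "continuous_on S (\<lambda>z. f'' b z b')"
      unfolding f''_def by (intro continuous_intros cR cq)
  qed
qed

text \<open>The map sending \<open>z\<close> to \<open>(x, 0) + R z\<close> preserves the half space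
  and multiplies heights by \<open>R\<close>: the volume contributes the exponent
  \<open>DIM('a) + 1\<close> and the weight contributes \<open>\<beta>\<close>. It serves both to
  normalize a cube to unit height and to compare dyadic balls.\<close>

lemma nn_integral_half_space_affine:
  fixes g :: "'a::euclidean_space \<times> real \<Rightarrow> ennreal"
  assumes g: "g \<in> borel_measurable borel" and R: "0 < R"
  shows "(\<integral>\<^sup>+z. g z * (ennreal (snd z powr \<beta>) * indicator {z. 0 < snd z} z) \<partial>lborel) =
    ennreal (R powr (real DIM('a) + 1 + \<beta>)) *
      (\<integral>\<^sup>+z. g ((x, 0) + R *\<^sub>R z) * (ennreal (snd z powr \<beta>) * indicator {z. 0 < snd z} z) \<partial>lborel)"
    (is "?L = _ * ?I")
proof -
  let ?W = "\<lambda>z::'a \<times> real. ennreal (snd z powr \<beta>) * indicator {z. 0 < snd z} z"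
  have H: "{z::'a \<times> real. 0 < snd z} \<in> sets borel"
    by (intro borel_open open_Collect_less continuous_intros)
  have snd_meas: "snd \<in> borel_measurable (borel :: ('a \<times> real) measure)"
    by (intro borel_measurable_continuous_onI continuous_intros)
  have W: "?W \<in> borel_measurable borel"
    using H snd_meas by (auto intro!: borel_measurable_times_ennreal borel_measurable_indicator)
  have "?L = ennreal (\<bar>R\<bar> ^ DIM('a \<times> real)) *
      (\<integral>\<^sup>+z. g ((x, 0) + R *\<^sub>R z) * ?W ((x, 0) + R *\<^sub>R z) \<partial>lborel)"
    by (rule nn_integral_lborel_affine) (use g W R in \<open>auto intro!: borel_measurable_times_ennreal\<close>)
  also have "(\<integral>\<^sup>+z. g ((x, 0) + R *\<^sub>R z) * ?W ((x, 0) + R *\<^sub>R z) \<partial>lborel) =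
      (\<integral>\<^sup>+z. ennreal (R powr \<beta>) * (g ((x, 0) + R *\<^sub>R z) * ?W z) \<partial>lborel)"
    using R by (intro nn_integral_cong)
      (auto simp: indicator_def powr_mult ennreal_mult zero_less_mult_iff mult_ac)
  also have "\<dots> = ennreal (R powr \<beta>) * ?I"
  proof (rule nn_integral_cmult)
    have "(\<lambda>z. g ((x, 0) + R *\<^sub>R z)) \<in> borel_measurable borel"
      by (rule measurable_compose[OF _ g]) simp
    then show "(\<lambda>z. g ((x, 0) + R *\<^sub>R z) * ?W z) \<in> borel_measurable lborel"
      using W by (auto intro!: borel_measurable_times_ennreal)
  qed
  also have "ennreal (\<bar>R\<bar> ^ DIM('a \<times> real)) * (ennreal (R powr \<beta>) * ?I) =
      ennreal (R powr (real DIM('a) + 1 + \<beta>)) * ?I"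
    using R by (simp add: mult.assoc[symmetric] ennreal_mult[symmetric] powr_add powr_realpow mult.commute[of R])
  finally show ?thesis .
qed

text \<open>The half ball lies in the product of a unit ball with an interval, so the integral is
  controlled by that of \<open>t powr \<beta>\<close> over \<open>{0..1}\<close>, which converges at
  the boundary because \<open>-1 < \<beta>\<close>.\<close>

lemma nn_integral_half_ball_finite:
  assumes \<beta>: "-1 < \<beta>"
  shows "(\<integral>\<^sup>+z. indicator (cball 0 1) z * (ennreal (snd z powr \<beta>) * indicator {z. 0 < snd z} z)
    \<partial>(lborel :: ('a::euclidean_space \<times> real) measure)) < \<infinity>"
proof -
  define h where "h t = ennreal (t powr \<beta>) * indicator {0..1} t" for t :: real
  have h: "h \<in> borel_measurable borel"
    unfolding h_def by (auto intro!: borel_measurable_times_ennreal borel_measurable_indicator)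
  have hI: "(\<integral>\<^sup>+t. h t \<partial>lborel) = ennreal (1 / (\<beta> + 1))"
    unfolding h_def
    by (rule nn_integral_has_integral_lebesgue') (use has_integral_powr_from_0[OF \<beta>, of 1] in auto)
  have ind: "(indicator (cball 0 1) :: 'a \<Rightarrow> ennreal) \<in> borel_measurable borel"
    by (intro borel_measurable_indicator) auto
  have "(\<integral>\<^sup>+z. indicator (cball 0 1) z * (ennreal (snd z powr \<beta>) * indicator {z. 0 < snd z} z)
      \<partial>(lborel :: ('a \<times> real) measure)) \<le>
      (\<integral>\<^sup>+z. indicator (cball 0 1) (fst z) * h (snd z) \<partial>(lborel :: ('a \<times> real) measure))"
  proof (rule nn_integral_mono)
    fix z :: "'a \<times> real"
    show "indicator (cball 0 1) z * (ennreal (snd z powr \<beta>) * indicator {z. 0 < snd z} z)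
        \<le> indicator (cball 0 1) (fst z) * h (snd z)"
      using norm_fst_le[of "fst z" "snd z"] norm_snd_le[of "snd z" "fst z"] by (auto simp: h_def indicator_def)
  qed
  also have "\<dots> = (\<integral>\<^sup>+z. indicator (cball 0 1) (fst z) * h (snd z) \<partial>((lborel :: 'a measure) \<Otimes>\<^sub>M (lborel :: real measure)))"
    by (simp add: lborel_prod)
  also have "\<dots> = (\<integral>\<^sup>+x. \<integral>\<^sup>+t. indicator (cball 0 1) x * h t \<partial>lborel \<partial>(lborel :: 'a measure))"
    using h ind by (subst lborel.nn_integral_fst[symmetric]) auto
  also have "\<dots> = (\<integral>\<^sup>+x. indicator (cball 0 1) x * ennreal (1 / (\<beta> + 1)) \<partial>(lborel :: 'a measure))"
    using h by (simp add: nn_integral_cmult hI)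
  also have "\<dots> = emeasure lborel (cball (0::'a) 1) * ennreal (1 / (\<beta> + 1))"
    using ind by (simp add: nn_integral_multc)
  also have "\<dots> < \<infinity>"
    by (simp add: emeasure_cball ennreal_mult[symmetric] ennreal_mult_less_top)
  finally show ?thesis .
qed

lemma norm_shift_up:
  fixes z :: "'a::real_normed_vector \<times> real"
  assumes "0 < snd z" "1 \<le> A"
  shows "1 \<le> norm (z + (0, A))" "norm z \<le> norm (z + (0, A))"
proof -
  show "1 \<le> norm (z + (0, A))"
    using norm_snd_le[of "snd z + A" "fst z"] assms by (cases z) simp
  show "norm z \<le> norm (z + (0, A))"
    using assms by (cases z) (auto simp: norm_Pair intro!: power_mono)
qed

text \<open>Dyadic decomposition: if \<open>2 ^ j\<close> is the least dyadic radius that reaches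
  \<open>z\<close>, the integrand is at most \<open>a j\<close> times the weight. By scaling, the
  ball of that radius has weighted volume \<open>V\<close> times the \<open>j\<close>-th power of
  \<open>2 powr (DIM('a) + 1 + \<beta>)\<close>. The assumption on \<open>K\<close> is exactly that
  the resulting geometric ratio \<open>\<rho>\<close> is below 1.\<close>

lemma nn_integral_shifted_power_finite:
  assumes \<beta>: "-1 < \<beta>" and A: "1 \<le> A" and K: "real DIM('a) + 1 + \<beta> < K"
  shows "(\<integral>\<^sup>+z. ennreal (norm (z + (0, A)) powr - K) * (ennreal (snd z powr \<beta>) * indicator {z. 0 < snd z} z)
    \<partial>(lborel :: ('a::euclidean_space \<times> real) measure)) < \<infinity>"
proof -
  let ?W = "\<lambda>z::'a \<times> real. ennreal (snd z powr \<beta>) * indicator {z. 0 < snd z} z"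
  define V where "V = (\<integral>\<^sup>+z. indicator (cball 0 1) z * ?W z \<partial>lborel)"
  have V: "V < \<infinity>" unfolding V_def by (rule nn_integral_half_ball_finite[OF \<beta>])
  have K0: "K > 0" using K \<beta> by linarith
  define \<rho> where "\<rho> = 2 powr (real DIM('a) + 1 + \<beta> - K)"
  have \<rho>: "0 < \<rho>" "\<rho> < 1"
    using K by (auto simp: \<rho>_def powr_less_one)
  \<comment> \<open>For \<open>j > 0\<close> this is \<open>(2 ^ (j - 1)) powr - K\<close>, the
    bound from the inner radius of the shell. At \<open>j = 0\<close> there is no inner radius, but
    the shift by \<open>A\<close> keeps the norm at least 1, and \<open>a 0 = 2 powr K\<close>
    exceeds 1.\<close>
  define a where "a j = 2 powr K * (2 powr - K) ^ j" for j :: nat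
  have a_nonneg: "0 \<le> a j" for j by (simp add: a_def)
  define B where "B j = (cball 0 (2 ^ j) :: ('a \<times> real) set)" for j :: nat
  have H: "{z::'a \<times> real. 0 < snd z} \<in> sets borel"
    by (intro borel_open open_Collect_less continuous_intros)
  have snd_meas: "snd \<in> borel_measurable (borel :: ('a \<times> real) measure)"
    by (intro borel_measurable_continuous_onI continuous_intros)
  have W: "?W \<in> borel_measurable borel"
    using H snd_meas by (auto intro!: borel_measurable_times_ennreal borel_measurable_indicator)
  have shell: "ennreal (norm (z + (0, A)) powr - K) * ?W z \<le>
      (\<Sum>j. ennreal (a j) * (indicator (B j) z * ?W z))" for z
  proof (cases "0 < snd z")
    case True
    obtain n :: nat where n: "norm z \<le> 2 ^ n"
      using real_arch_pow[of 2 "norm z"] by (auto intro: less_imp_le)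
    define j where "j = (LEAST j. norm z \<le> 2 ^ j)"
    have j: "norm z \<le> 2 ^ j"
      unfolding j_def using n by (rule LeastI)
    have "norm (z + (0, A)) powr - K \<le> a j"
    proof (cases j)
      case 0
      have "norm (z + (0, A)) powr - K \<le> 1 powr - K"
        using norm_shift_up(1)[OF True A] K0 by (intro powr_mono2') auto
      also have "\<dots> \<le> a j"
        using K0 by (simp add: a_def 0 ge_one_powr_ge_zero)
      finally show ?thesis .
    next
      case (Suc i)
      have "\<not> norm z \<le> 2 ^ i"
        using not_less_Least[of i "\<lambda>j. norm z \<le> 2 ^ j"] Suc unfolding j_def by simp
      then have "2 ^ i \<le> norm (z + (0, A))"
        using norm_shift_up(2)[OF True A] by linarith
      then have "norm (z + (0, A)) powr - K \<le> (2 ^ i) powr - K"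
        using K0 by (intro powr_mono2') auto
      also have "\<dots> = (2 powr - K) ^ i"
        by (simp add: powr_realpow[symmetric] powr_powr mult.commute)
      also have "\<dots> = a j"
        by (simp add: a_def Suc powr_add[symmetric] mult.assoc[symmetric])
      finally show ?thesis .
    qed
    then have "ennreal (norm (z + (0, A)) powr - K) * ?W z \<le> ennreal (a j) * (indicator (B j) z * ?W z)"
      using j by (auto simp: B_def intro!: mult_right_mono ennreal_leI)
    also have "\<dots> \<le> (\<Sum>j. ennreal (a j) * (indicator (B j) z * ?W z))"
      using sum_le_suminf[of "\<lambda>j. ennreal (a j) * (indicator (B j) z * ?W z)" "{j}"] by simp
    finally show ?thesis .
  qed simp
  have ind: "(indicator (B j) :: _ \<Rightarrow> ennreal) \<in> borel_measurable borel" for j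
    unfolding B_def by (intro borel_measurable_indicator) auto
  have "(\<integral>\<^sup>+z. ennreal (norm (z + (0, A)) powr - K) * ?W z \<partial>lborel) \<le>
      (\<integral>\<^sup>+z. (\<Sum>j. ennreal (a j) * (indicator (B j) z * ?W z)) \<partial>lborel)"
    by (intro nn_integral_mono shell)
  also have "\<dots> = (\<Sum>j. \<integral>\<^sup>+z. ennreal (a j) * (indicator (B j) z * ?W z) \<partial>lborel)"
    using W ind by (intro nn_integral_suminf) (auto intro!: borel_measurable_times_ennreal)
  also have "\<dots> = (\<Sum>j. ennreal (2 powr K * \<rho> ^ j) * V)"
  proof (rule suminf_cong)
    fix j
    have "(\<integral>\<^sup>+z. ennreal (a j) * (indicator (B j) z * ?W z) \<partial>lborel) =
        ennreal (a j) * (\<integral>\<^sup>+z. indicator (B j) z * ?W z \<partial>lborel)"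
      using W ind by (intro nn_integral_cmult) (auto intro!: borel_measurable_times_ennreal)
    also have "(\<integral>\<^sup>+z. indicator (B j) z * ?W z \<partial>lborel) = ennreal ((2 ^ j) powr (real DIM('a) + 1 + \<beta>)) *
       (\<integral>\<^sup>+z. indicator (B j) ((0, 0) + 2 ^ j *\<^sub>R z) * ?W z \<partial>lborel)"
      by (rule nn_integral_half_space_affine[OF ind]) simp
    also have "(\<lambda>z. indicator (B j) ((0, 0) + 2 ^ j *\<^sub>R z) :: ennreal) = indicator (cball 0 1)"
      by (auto simp: fun_eq_iff B_def indicator_def zero_prod_def[symmetric])
    finally have "(\<integral>\<^sup>+z. ennreal (a j) * (indicator (B j) z * ?W z) \<partial>lborel) =
        ennreal (a j) * (ennreal ((2 ^ j) powr (real DIM('a) + 1 + \<beta>)) * V)"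
      unfolding V_def .
    also have "\<dots> = ennreal (a j * (2 ^ j) powr (real DIM('a) + 1 + \<beta>)) * V"
      using a_nonneg[of j] by (simp add: mult.assoc[symmetric] ennreal_mult)
    also have "a j * (2 ^ j) powr (real DIM('a) + 1 + \<beta>) = 2 powr K * \<rho> ^ j"
    proof -
      have "(2 ^ j) powr u = (2 powr u) ^ j" for u :: real
        by (simp add: powr_realpow[symmetric] powr_powr mult.commute)
      then show ?thesis
        by (simp add: a_def \<rho>_def power_mult_distrib[symmetric] powr_add[symmetric] mult.assoc)
    qed
    finally show "(\<integral>\<^sup>+z. ennreal (a j) * (indicator (B j) z * ?W z) \<partial>lborel) = ennreal (2 powr K * \<rho> ^ j) * V" .
  qed
  also have "\<dots> = (\<Sum>j. ennreal (2 powr K * \<rho> ^ j)) * V"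
    by (rule ennreal_suminf_multc)
  also have "(\<Sum>j. ennreal (2 powr K * \<rho> ^ j)) = ennreal (\<Sum>j. 2 powr K * \<rho> ^ j)"
    using \<rho> by (intro suminf_ennreal2 summable_mult summable_geometric) auto
  also have "\<dots> * V < \<infinity>"
    using V by (simp add: ennreal_mult_less_top)
  finally show ?thesis .
qed

section \<open>Bergman norms, and size and positivity of the test functions\<close>

lemma ennreal_powr_ennreal: "0 \<le> x \<Longrightarrow> ennreal_powr (ennreal x) a = ennreal (x powr a)"
  by (simp add: ennreal_powr_def)

lemma ennreal_powr_top [simp]: "ennreal_powr top a = top"
  by (simp add: ennreal_powr_def)

lemma ennreal_powr_mono:
  assumes "x \<le> y" "0 < a"
  shows "ennreal_powr x a \<le> ennreal_powr y a"
proof (cases "y = \<infinity>")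
  case False
  with assms have "x < \<infinity>" "y < \<infinity>"
    by (auto simp: top.not_eq_extremum)
  then obtain u v where "x = ennreal u" "0 \<le> u" "y = ennreal v" "0 \<le> v"
    by (cases x; cases y) auto
  then show ?thesis
    using assms by (auto simp: ennreal_powr_ennreal intro!: ennreal_leI powr_mono2)
qed simp

lemma bergman_norm_eq:
  assumes "(\<integral>\<^sup>+z\<in>upper_half_space. ennreal (\<bar>f z\<bar> powr s * snd z powr \<beta>) \<partial>lborel) = ennreal i" "0 \<le> i"
  shows "bergman_norm s \<beta> f = ennreal (i powr (1 / s))"
  using assms by (simp add: bergman_norm_def ennreal_powr_ennreal)

lemma bergman_space_integral:
  assumes "f \<in> bergman_space s \<beta>"
  obtains i where "0 \<le> i"
    "(\<integral>\<^sup>+z\<in>upper_half_space. ennreal (\<bar>f z\<bar> powr s * snd z powr \<beta>) \<partial>lborel) = ennreal i"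
    "bergman_norm s \<beta> f = ennreal (i powr (1 / s))"
proof -
  let ?I = "\<integral>\<^sup>+z\<in>upper_half_space. ennreal (\<bar>f z\<bar> powr s * snd z powr \<beta>) \<partial>lborel"
  have "?I \<noteq> \<infinity>"
    using assms by (auto simp: bergman_space_def bergman_norm_def)
  then obtain i where "0 \<le> i" "?I = ennreal i"
    by (cases ?I) auto
  then show thesis
    using that bergman_norm_eq by blast
qed

lemma planar_scaleR: "planar e e' (a *\<^sub>R z) = of_real a * planar e e' z"
  by (simp add: planar_def complex_eq_iff)

lemma norm_planar_le:
  fixes z :: "'a::euclidean_space"
  assumes "e \<in> Basis" "e' \<in> Basis" "e \<noteq> e'"
  shows "norm (planar e e' z) \<le> norm z"
proof -
  have "(\<Sum>b\<in>{e, e'}. (z \<bullet> b) * (z \<bullet> b)) \<le> (\<Sum>b\<in>Basis. (z \<bullet> b) * (z \<bullet> b))"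
    using assms by (intro sum_mono2) auto
  then have "(z \<bullet> e)\<^sup>2 + (z \<bullet> e')\<^sup>2 \<le> (norm z)\<^sup>2"
    using assms(3) by (simp add: sum_Basis_inner_square power2_eq_square dot_square_norm[symmetric])
      (simp add: power2_norm_eq_inner[unfolded power2_eq_square])
  then show ?thesis
    by (simp add: planar_def cmod_def real_le_lsqrt)
qed

lemma inner_powr_half:
  fixes z :: "'a::real_inner"
  shows "(z \<bullet> z) powr (u / 2) = norm z powr u"
proof (cases "z = 0")
  case False
  then have "(z \<bullet> z) powr (u / 2) = (norm z powr 2) powr (u / 2)"
    by (simp add: dot_square_norm)
  also have "\<dots> = norm z powr u" unfolding powr_powr by simp
  finally show ?thesis .
qed simp

text \<open>The polynomial grows at most like the \<open>J\<close>-th power of the norm, while the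
  radial factor decays to order \<open>DIM('a) - 2 + 2 * J\<close>. The net decay still improves
  with \<open>J\<close>.\<close>

lemma abs_kelvin_le:
  fixes z :: "'a::euclidean_space"
  assumes e: "e \<in> Basis" "e' \<in> Basis" "e \<noteq> e'" and z: "z \<noteq> 0"
  shows "\<bar>kelvin e e' J z\<bar> \<le> norm z powr - (real DIM('a) - 2 + real J)"
proof -
  have "\<bar>Re (planar e e' z ^ J)\<bar> \<le> norm (planar e e' z) ^ J"
    by (metis abs_Re_le_cmod norm_power)
  also have "\<dots> \<le> norm z ^ J"
    using norm_planar_le[OF e] by (intro power_mono) auto
  also have "\<dots> = norm z powr real J"
    using z by (simp add: powr_realpow)
  finally have "\<bar>kelvin e e' J z\<bar> \<le> norm z powr real J * (z \<bullet> z) powr (- ((real DIM('a) - 2) / 2 + real J))"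
    unfolding kelvin_def abs_mult by (intro mult_mono) auto
  also have "- ((real DIM('a) - 2) / 2 + real J) = (- (real DIM('a) - 2 + 2 * real J)) / 2"
    by (simp add: field_simps)
  also have "norm z powr real J * (z \<bullet> z) powr ((- (real DIM('a) - 2 + 2 * real J)) / 2) =
      norm z powr - (real DIM('a) - 2 + real J)"
    unfolding inner_powr_half by (simp add: powr_add[symmetric])
  finally show ?thesis .
qed

lemma kelvin_scaleR:
  fixes z :: "'a::euclidean_space"
  assumes a: "0 < a"
  shows "kelvin e e' J (a *\<^sub>R z) = a powr - (real DIM('a) - 2 + real J) * kelvin e e' J z"
proof -
  have "kelvin e e' J (a *\<^sub>R z) = a powr real J * (a powr 2) powr (- ((real DIM('a) - 2) / 2 + real J)) * kelvin e e' J z"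
    using a by (simp add: kelvin_def planar_scaleR power_mult_distrib of_real_power[symmetric] powr_mult powr_realpow
        power2_eq_square del: of_real_power)
  also have "a powr real J * (a powr 2) powr (- ((real DIM('a) - 2) / 2 + real J)) = a powr - (real DIM('a) - 2 + real J)"
    unfolding powr_powr powr_add[symmetric] by (rule arg_cong) (simp add: field_simps)
  finally show ?thesis .
qed

text \<open>Continuity at \<open>e\<close>, where \<open>kelvin\<close> has the value 1. Together
  with \<open>kelvin_scaleR\<close> this yields positivity on a narrow cone with vertex at the pole
  and axis \<open>e\<close>.\<close>

lemma kelvin_near_pole:
  fixes e :: "'a::euclidean_space"
  assumes e: "e \<in> Basis" "e' \<in> Basis" "e \<noteq> e'"
  obtains \<delta> where "0 < \<delta>" "\<And>u. norm u < \<delta> \<Longrightarrow> 1 / 2 < kelvin e e' J (e + u)"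
proof -
  have "e \<noteq> 0" using e by auto
  then have "((\<lambda>z. kelvin e e' J z) \<longlongrightarrow> kelvin e e' J e) (at e)"
    unfolding kelvin_def by (intro tendsto_intros bounded_linear.tendsto[OF bounded_linear_planar]) auto
  moreover have "kelvin e e' J e = 1"
    using e by (simp add: kelvin_def planar_def inner_Basis complex_eq_iff Complex_eq_1)
  ultimately have "eventually (\<lambda>z. 1 / 2 < kelvin e e' J z) (at e)"
    by (intro order_tendstoD(1)) auto
  then obtain \<delta> where \<delta>: "\<delta> > 0" "\<And>z. z \<noteq> e \<Longrightarrow> dist z e < \<delta> \<Longrightarrow> 1 / 2 < kelvin e e' J z"
    by (auto simp: eventually_at)
  have "1 / 2 < kelvin e e' J (e + u)" if "norm u < \<delta>" for u
    using \<delta>(2)[of "e + u"] that \<open>kelvin e e' J e = 1\<close> by (cases "u = 0") (auto simp: dist_norm)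
  then show thesis using that \<delta>(1) by blast
qed

lemma open_upper_half_space: "open upper_half_space"
  unfolding upper_half_space_def by (intro open_Collect_less continuous_intros)

text \<open>The pole is at \<open>(\<xi>, - A * \<eta>)\<close>. Translating by \<open>\<xi>\<close>
  and dilating by \<open>\<eta>\<close> moves it to \<open>(0, - A)\<close>, so one integral,
  independent of \<open>\<xi>\<close> and \<open>\<eta>\<close>, supplies the constant, and
  homogeneity supplies the power of \<open>\<eta>\<close>. \<open>M\<close> is the order of decay of
  \<open>kelvin\<close> in dimension \<open>CARD('n) + 1\<close>, and the assumption on
  \<open>M * s\<close> is integrability at infinity.\<close>

lemma kelvin_bergman:
  fixes e e' :: "(real^'n) \<times> real"
  assumes e: "e \<in> Basis" "e' \<in> Basis" "e \<noteq> e'"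
    and s: "0 < s" and \<beta>: "-1 < \<beta>" and A: "1 \<le> A"
    and M: "M = real CARD('n) - 1 + real J" and Ms: "real CARD('n) + 1 + \<beta> < M * s"
  shows "\<exists>L>0. \<forall>\<xi> \<eta>. 0 < \<eta> \<longrightarrow>
    (\<lambda>z. kelvin e e' J (z + (- \<xi>, A * \<eta>))) \<in> bergman_space s \<beta> \<and>
    bergman_norm s \<beta> (\<lambda>z. kelvin e e' J (z + (- \<xi>, A * \<eta>))) \<le>
      ennreal (L * \<eta> powr ((real CARD('n) + 1 + \<beta>) / s - M))"
proof -
  let ?W = "\<lambda>z::(real^'n) \<times> real. ennreal (snd z powr \<beta>) * indicator {z. 0 < snd z} z"
  let ?I = "\<integral>\<^sup>+z. ennreal (norm (z + (0, A)) powr - (M * s)) * ?W z \<partial>lborel"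
  have "?I < \<infinity>"
    by (rule nn_integral_shifted_power_finite[OF \<beta> A]) (use Ms in simp)
  then obtain i where i: "0 \<le> i" "?I = ennreal i"
    by (cases ?I) auto
  show ?thesis
  \<comment> \<open>Adding 1 makes the constant positive without showing that the integral
    \<open>i\<close> is.\<close>
  proof (intro exI[of _ "(i + 1) powr (1 / s)"] conjI allI impI)
    show "0 < (i + 1) powr (1 / s)" using i by simp
    fix \<xi> :: "real^'n" and \<eta> :: real assume \<eta>: "0 < \<eta>"
    let ?v = "(- \<xi>, A * \<eta>)"
    let ?f = "\<lambda>z. kelvin e e' J (z + ?v)"
    have nz: "z + ?v \<noteq> 0" if "z \<in> upper_half_space" for z
    proof -
      have "0 < snd (z + ?v)"
        using that A \<eta> by (simp add: upper_half_space_def add_pos_pos)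
      then show ?thesis by (metis order_less_irrefl snd_zero)
    qed
    let ?g = "\<lambda>z. ennreal (norm (z + ?v) powr - (M * s))"
    have g: "?g \<in> borel_measurable borel"
      by measurable
    have "(\<integral>\<^sup>+z\<in>upper_half_space. ennreal (\<bar>?f z\<bar> powr s * snd z powr \<beta>) \<partial>lborel) \<le>
        (\<integral>\<^sup>+z. ?g z * ?W z \<partial>lborel)"
    proof (rule nn_integral_mono)
      fix z :: "(real^'n) \<times> real"
      show "ennreal (\<bar>?f z\<bar> powr s * snd z powr \<beta>) * indicator upper_half_space z \<le> ?g z * ?W z"
      proof (cases "z \<in> upper_half_space")
        case True
        have "\<bar>?f z\<bar> \<le> norm (z + ?v) powr - M"
          using abs_kelvin_le[OF e nz[OF True], of J] by (simp add: M)
        then have "\<bar>?f z\<bar> powr s \<le> (norm (z + ?v) powr - M) powr s"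
          using s by (intro powr_mono2) auto
        also have "\<dots> = norm (z + ?v) powr - (M * s)"
          by (simp add: powr_powr)
        finally have "ennreal (\<bar>?f z\<bar> powr s * snd z powr \<beta>) \<le> ennreal (norm (z + ?v) powr - (M * s) * snd z powr \<beta>)"
          by (intro ennreal_leI mult_right_mono) auto
        then show ?thesis
          using True by (simp add: upper_half_space_def ennreal_mult)
      qed simp
    qed
    also have "\<dots> = ennreal (\<eta> powr (real CARD('n) + 1 + \<beta>)) * (\<integral>\<^sup>+z. ?g ((\<xi>, 0) + \<eta> *\<^sub>R z) * ?W z \<partial>lborel)"
      using nn_integral_half_space_affine[OF g \<eta>, of \<beta> \<xi>] by simp
    also have "(\<integral>\<^sup>+z. ?g ((\<xi>, 0) + \<eta> *\<^sub>R z) * ?W z \<partial>lborel) =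
        (\<integral>\<^sup>+z. ennreal (\<eta> powr - (M * s)) * (ennreal (norm (z + (0, A)) powr - (M * s)) * ?W z) \<partial>lborel)"
    proof (rule nn_integral_cong)
      fix z :: "(real^'n) \<times> real"
      have "(\<xi>, 0) + \<eta> *\<^sub>R z + ?v = \<eta> *\<^sub>R (z + (0, A))"
        by (cases z) (simp add: algebra_simps)
      then show "?g ((\<xi>, 0) + \<eta> *\<^sub>R z) * ?W z =
          ennreal (\<eta> powr - (M * s)) * (ennreal (norm (z + (0, A)) powr - (M * s)) * ?W z)"
        using \<eta> by (simp add: powr_mult ennreal_mult mult.assoc del: scaleR_add_right)
    qed
    also have "\<dots> = ennreal (\<eta> powr - (M * s)) * ?I"
    proof (rule nn_integral_cmult)
      have H: "{z::(real^'n) \<times> real. 0 < snd z} \<in> sets borel"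
        by (intro borel_open open_Collect_less continuous_intros)
      have "snd \<in> borel_measurable (borel :: ((real^'n) \<times> real) measure)"
        by (intro borel_measurable_continuous_onI continuous_intros)
      with H show "(\<lambda>z. ennreal (norm (z + (0, A)) powr - (M * s)) * ?W z) \<in> borel_measurable lborel"
        by (auto intro!: borel_measurable_times_ennreal borel_measurable_indicator)
    qed
    also have "ennreal (\<eta> powr (real CARD('n) + 1 + \<beta>)) * (ennreal (\<eta> powr - (M * s)) * ?I) =
        ennreal (\<eta> powr (real CARD('n) + 1 + \<beta> - M * s) * i)"
      unfolding i(2) using i(1) by (simp add: ennreal_mult[symmetric] mult.assoc[symmetric] powr_add[symmetric])
    finally have le: "(\<integral>\<^sup>+z\<in>upper_half_space. ennreal (\<bar>?f z\<bar> powr s * snd z powr \<beta>) \<partial>lborel) \<le>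
        ennreal (\<eta> powr (real CARD('n) + 1 + \<beta> - M * s) * i)" .
    have "bergman_norm s \<beta> ?f \<le> ennreal_powr (ennreal (\<eta> powr (real CARD('n) + 1 + \<beta> - M * s) * i)) (1 / s)"
      unfolding bergman_norm_def using s by (intro ennreal_powr_mono le) auto
    also have "\<dots> = ennreal (i powr (1 / s) * \<eta> powr ((real CARD('n) + 1 + \<beta>) / s - M))"
      using i s \<eta> by (simp add: ennreal_powr_ennreal powr_mult powr_powr diff_divide_distrib)
    also have "\<dots> \<le> ennreal ((i + 1) powr (1 / s) * \<eta> powr ((real CARD('n) + 1 + \<beta>) / s - M))"
      using i s by (intro ennreal_leI mult_right_mono powr_mono2) auto
    finally show norm: "bergman_norm s \<beta> ?f \<le> ennreal ((i + 1) powr (1 / s) * \<eta> powr ((real CARD('n) + 1 + \<beta>) / s - M))" .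
    show "?f \<in> bergman_space s \<beta>"
      unfolding bergman_space_def
      using harmonic_on_kelvin[OF e open_upper_half_space nz] le_less_trans[OF norm ennreal_less_top] by auto
  qed
qed

text \<open>\<open>F\<close> and its order \<open>M\<close> do not depend on \<open>i\<close>, so
  that one function can be used in all \<open>m\<close> slots. The lower bound is stated on a ball
  about the boundary point below the center; \<open>T\<close> will be chosen so that the ball
  contains the whole cube.\<close>

lemma bergman_test_functions:
  fixes s T :: real and \<beta> :: "nat \<Rightarrow> real"
  assumes s: "0 < s" and T: "0 < T" and \<beta>: "\<And>i. i \<in> {1..m} \<Longrightarrow> -1 < \<beta> i"
  obtains c M :: real and L :: "nat \<Rightarrow> real" and F :: "real^'n \<Rightarrow> real \<Rightarrow> (real^'n) \<times> real \<Rightarrow> real"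
  where "0 < c" and "\<And>i. i \<in> {1..m} \<Longrightarrow> 0 < L i"
    and "\<And>i \<xi> \<eta>. i \<in> {1..m} \<Longrightarrow> 0 < \<eta> \<Longrightarrow> F \<xi> \<eta> \<in> bergman_space s (\<beta> i)"
    and "\<And>i \<xi> \<eta>. i \<in> {1..m} \<Longrightarrow> 0 < \<eta> \<Longrightarrow> bergman_norm s (\<beta> i) (F \<xi> \<eta>) \<le>
           ennreal (L i * \<eta> powr ((real CARD('n) + 1 + \<beta> i) / s - M))"
    and "\<And>\<xi> \<eta> z. 0 < \<eta> \<Longrightarrow> norm (z - (\<xi>, 0)) \<le> T * \<eta> \<Longrightarrow> c * \<eta> powr - M \<le> F \<xi> \<eta> z"
proof -
  \<comment> \<open>Any coordinate gives a horizontal direction for \<open>e'\<close>. The vertical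
    choice of \<open>e\<close> makes the cone of positivity point upwards from the pole.\<close>
  obtain k :: 'n where True by simp
  define e e' where "e = (0 :: real^'n, 1 :: real)" and "e' = (axis k 1 :: real^'n, 0 :: real)"
  have e: "e \<in> Basis" "e' \<in> Basis" "e \<noteq> e'"
    by (auto simp: e_def e'_def Basis_prod_def axis_in_Basis_iff Basis_real_def axis_eq_0_iff zero_prod_def)
  \<comment> \<open>A common upper bound for all the weights, so that a single \<open>J\<close>
    suffices.\<close>
  define b where "b = (\<Sum>i\<in>{1..m}. \<bar>\<beta> i\<bar>)"
  obtain J :: nat where J: "(real CARD('n) + 1 + b) / s < real J"
    using reals_Archimedean2 by blast
  define M where "M = real CARD('n) - 1 + real J"
  have Ms: "real CARD('n) + 1 + \<beta> i < M * s" if i: "i \<in> {1..m}" for i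
  proof -
    have "\<beta> i \<le> b"
      using member_le_sum[of i "{1..m}" "\<lambda>i. \<bar>\<beta> i\<bar>"] i by (simp add: b_def)
    moreover have "real CARD('n) + 1 + b < real J * s"
      using J s by (simp add: field_simps)
    moreover have "real J * s \<le> M * s"
      using s by (intro mult_right_mono) (auto simp: M_def Suc_leI)
    ultimately show ?thesis by linarith
  qed
  obtain \<delta> where \<delta>: "0 < \<delta>" "\<And>u. norm u < \<delta> \<Longrightarrow> 1 / 2 < kelvin e e' J (e + u)"
    using kelvin_near_pole[OF e] by blast
  \<comment> \<open>Seen from the pole at depth \<open>A * \<eta>\<close>, a ball of radius
    \<open>T * \<eta>\<close> about \<open>(\<xi>, 0)\<close> has relative radius
    \<open>T / A\<close>, which this choice makes smaller than \<open>\<delta>\<close>. The summand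
    1 gives \<open>1 \<le> A\<close>, which keeps the pole away in the norm estimate.\<close>
  define A where "A = 1 + T / \<delta>"
  have A: "1 \<le> A" "T < \<delta> * A"
    using \<delta> T by (auto simp: A_def field_simps)
  define F where "F \<xi> \<eta> z = kelvin e e' J (z + (- \<xi>, A * \<eta>))" for \<xi> \<eta> z
  have "\<forall>i\<in>{1..m}. \<exists>L>0. \<forall>\<xi> \<eta>. 0 < \<eta> \<longrightarrow> F \<xi> \<eta> \<in> bergman_space s (\<beta> i) \<and>
    bergman_norm s (\<beta> i) (F \<xi> \<eta>) \<le> ennreal (L * \<eta> powr ((real CARD('n) + 1 + \<beta> i) / s - M))"
    unfolding F_def using kelvin_bergman[OF e s \<beta> A(1) M_def Ms] by blast
  then obtain L where L: "\<And>i. i \<in> {1..m} \<Longrightarrow> 0 < L i \<and> (\<forall>\<xi> \<eta>. 0 < \<eta> \<longrightarrow> F \<xi> \<eta> \<in> bergman_space s (\<beta> i) \<and>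
    bergman_norm s (\<beta> i) (F \<xi> \<eta>) \<le> ennreal (L i * \<eta> powr ((real CARD('n) + 1 + \<beta> i) / s - M)))"
    by metis
  have lower: "A powr - M / 2 * \<eta> powr - M \<le> F \<xi> \<eta> z" if \<eta>: "0 < \<eta>" and z: "norm (z - (\<xi>, 0)) \<le> T * \<eta>" for \<xi> \<eta> z
  proof -
    define u where "u = (1 / (A * \<eta>)) *\<^sub>R (z - (\<xi>, 0))"
    have A\<eta>: "0 < A * \<eta>" using A \<eta> by simp
    have "norm u = norm (z - (\<xi>, 0)) / (A * \<eta>)"
      using A\<eta> by (simp add: u_def)
    also have "\<dots> \<le> T * \<eta> / (A * \<eta>)"
      using z A\<eta> by (intro divide_right_mono) auto
    also have "\<dots> < \<delta>"
      using A \<eta> by (simp add: field_simps)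
    finally have u: "1 / 2 < kelvin e e' J (e + u)" by (rule \<delta>(2))
    have "(A * \<eta>) *\<^sub>R (e + u) = z + (- \<xi>, A * \<eta>)"
    proof -
      have "(A * \<eta>) *\<^sub>R u = z - (\<xi>, 0)"
        using A \<eta> by (simp add: u_def)
      then show ?thesis
        unfolding scaleR_add_right by (cases z) (simp add: e_def)
    qed
    then have "F \<xi> \<eta> z = kelvin e e' J ((A * \<eta>) *\<^sub>R (e + u))"
      by (simp add: F_def)
    also have "\<dots> = (A * \<eta>) powr - M * kelvin e e' J (e + u)"
      using kelvin_scaleR[OF A\<eta>, of e e' J "e + u"] by (simp add: M_def)
    finally have "F \<xi> \<eta> z = (A * \<eta>) powr - M * kelvin e e' J (e + u)" .
    moreover have "(A * \<eta>) powr - M * (1 / 2) \<le> (A * \<eta>) powr - M * kelvin e e' J (e + u)"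
      using u by (intro mult_left_mono) auto
    moreover have "(A * \<eta>) powr - M = A powr - M * \<eta> powr - M"
      using A \<eta> by (simp add: powr_mult)
    ultimately show ?thesis by simp
  qed
  show thesis
    using A by (intro that[of "A powr - M / 2" L F M] lower) (use L in auto)
qed

section \<open>Whitney cubes\<close>

lemma frontier_upper_half_space: "frontier upper_half_space = {z :: (real^'n) \<times> real. snd z = 0}"
proof -
  have "(upper_half_space :: ((real^'n) \<times> real) set) = {z. (0, 1) \<bullet> z > 0}"
    by (auto simp: upper_half_space_def inner_prod_def)
  moreover have "frontier {z :: (real^'n) \<times> real. (0, 1) \<bullet> z > 0} = {z. (0, 1) \<bullet> z = 0}"
    by (rule frontier_halfspace_gt) (simp add: zero_prod_def)
  ultimately show ?thesis by (simp add: inner_prod_def)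
qed

lemma closed_cube_edges:
  fixes c :: "'a::euclidean_space"
  assumes "0 < l"
  shows "z \<in> closed_cube c l \<longleftrightarrow> (\<forall>b\<in>Basis. \<bar>(z - c) \<bullet> b\<bar> \<le> l / 2)"
proof -
  define h where "h = l / 2"
  show ?thesis
    unfolding closed_cube_def h_def[symmetric]
    by (auto simp: mem_box inner_diff_left inner_add_left abs_le_iff algebra_simps)
qed

lemma dist_closed_cube_center:
  fixes c :: "'a::euclidean_space"
  assumes "0 < l" "z \<in> closed_cube c l"
  shows "dist z c \<le> l * norm (One :: 'a)"
proof -
  have "norm (z - c) \<le> norm (l *\<^sub>R One :: 'a)"
    by (rule norm_le_componentwise) (use assms closed_cube_edges[OF assms(1)] in force)
  then show ?thesis using assms by (simp add: dist_norm)
qed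

lemma diameter_closed_cube:
  fixes c :: "'a::euclidean_space"
  assumes "0 < l"
  shows "diameter (closed_cube c l) = l * norm (One :: 'a)"
proof -
  have "diameter (closed_cube c l) = dist (c - (l / 2) *\<^sub>R One) (c + (l / 2) *\<^sub>R One)"
    unfolding closed_cube_def
    by (rule diameter_cbox) (use assms in \<open>simp add: inner_diff_left inner_add_left\<close>)
  also have "\<dots> = norm (l *\<^sub>R One :: 'a)"
    by (simp add: dist_norm norm_minus_commute scaleR_add_left[symmetric] algebra_simps)
  finally show ?thesis using assms by simp
qed

lemma emeasure_interior_closed_cube:
  fixes c :: "'a::euclidean_space"
  assumes "0 < l"
  shows "emeasure lborel (interior (closed_cube c l)) = ennreal (l ^ DIM('a))"
proof -
  have "emeasure lborel (box (c - (l / 2) *\<^sub>R One) (c + (l / 2) *\<^sub>R One)) =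
      (\<Prod>b\<in>Basis. ((c + (l / 2) *\<^sub>R One) - (c - (l / 2) *\<^sub>R One)) \<bullet> b)"
    by (rule emeasure_lborel_box) (use assms in \<open>simp add: inner_diff_left inner_add_left\<close>)
  also have "\<dots> = ennreal (l ^ DIM('a))"
    by (simp add: inner_diff_left inner_add_left)
  finally show ?thesis
    by (simp add: closed_cube_def interior_cbox)
qed

text \<open>The Whitney condition with distances to the boundary replaced by the height of the
  center: the edge, and the height of the bottom face, are comparable to \<open>\<eta> k\<close>.
  One constant \<open>a\<close> serves for both lower bounds.\<close>

locale whitney_cubes =
  fixes \<xi> :: "nat \<Rightarrow> real^'n" and \<eta> l :: "nat \<Rightarrow> real" and a b :: real
  assumes a: "0 < a" and b: "0 < b"
    and edge_lower: "\<And>k. a * \<eta> k \<le> l k" and edge_upper: "\<And>k. l k \<le> b * \<eta> k"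
    and bottom: "\<And>k. a * \<eta> k \<le> \<eta> k - l k / 2"
    and height_pos: "\<And>k. 0 < \<eta> k"
    and disjoint: "\<And>j k. j \<noteq> k \<Longrightarrow>
      interior (closed_cube (\<xi> j, \<eta> j) (l j)) \<inter> interior (closed_cube (\<xi> k, \<eta> k) (l k)) = {}"
begin

definition cube :: "nat \<Rightarrow> ((real^'n) \<times> real) set" where
  "cube k = closed_cube (\<xi> k, \<eta> k) (l k)"

text \<open>A radius in units of \<open>\<eta> k\<close>: the first term reaches every point of the
  cube, the second leaves room for the mean value balls around these points.\<close>

definition spread :: real where
  "spread = b * norm (One :: (real^'n) \<times> real) + a"

text \<open>Stands in for the cube enlarged by 5/4. It has to contain a ball of radius comparable to
  \<open>\<eta> k\<close> around every point of the cube, while its heights stay comparable to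
  \<open>\<eta> k\<close>. A ball of radius \<open>spread * \<eta> k\<close> alone could cross the
  boundary, hence the cut at a fixed fraction of the height.\<close>

definition enlarged :: "nat \<Rightarrow> ((real^'n) \<times> real) set" where
  "enlarged k = cball (\<xi> k, \<eta> k) (spread * \<eta> k) \<inter> {z. a / 2 * \<eta> k \<le> snd z}"

lemma edge_pos: "0 < l k"
  using mult_pos_pos[OF a height_pos[of k]] edge_lower[of k] by linarith

lemma spread_pos: "0 < spread"
  using a b by (simp add: spread_def add_nonneg_pos)

lemma cube_dist: "z \<in> cube k \<Longrightarrow> dist z (\<xi> k, \<eta> k) \<le> b * norm (One :: (real^'n) \<times> real) * \<eta> k"
proof -
  assume "z \<in> cube k"
  then have "dist z (\<xi> k, \<eta> k) \<le> l k * norm (One :: (real^'n) \<times> real)"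
    unfolding cube_def using edge_pos by (rule dist_closed_cube_center[rotated])
  also have "\<dots> \<le> b * \<eta> k * norm (One :: (real^'n) \<times> real)"
    using edge_upper by (intro mult_right_mono) auto
  finally show ?thesis by (simp add: mult_ac)
qed

lemma cube_height: "z \<in> cube k \<Longrightarrow> a * \<eta> k \<le> snd z"
proof -
  assume "z \<in> cube k"
  then have "\<bar>(z - (\<xi> k, \<eta> k)) \<bullet> (0, 1)\<bar> \<le> l k / 2"
    unfolding cube_def closed_cube_edges[OF edge_pos] by (simp add: Basis_prod_def)
  moreover have "(z - (\<xi> k, \<eta> k)) \<bullet> (0, 1) = snd z - \<eta> k"
    by (simp add: inner_prod_def)
  ultimately have "\<eta> k - l k / 2 \<le> snd z"
    by linarith
  then show ?thesis using bottom[of k] by linarith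
qed

lemma cball_subset_enlarged:
  assumes "z \<in> cube k"
  shows "cball z (a / 2 * \<eta> k) \<subseteq> enlarged k"
proof
  fix y assume y: "y \<in> cball z (a / 2 * \<eta> k)"
  have "dist y (\<xi> k, \<eta> k) \<le> dist z y + dist z (\<xi> k, \<eta> k)"
    by (metis dist_commute dist_triangle)
  also have "\<dots> \<le> a / 2 * \<eta> k + b * norm (One :: (real^'n) \<times> real) * \<eta> k"
    using y cube_dist[OF assms] by simp
  also have "\<dots> \<le> spread * \<eta> k"
    using a height_pos[of k] by (simp add: spread_def algebra_simps)
  finally have 1: "dist (\<xi> k, \<eta> k) y \<le> spread * \<eta> k" by (simp add: dist_commute)
  have "\<bar>snd z - snd y\<bar> \<le> a / 2 * \<eta> k"
    using dist_snd_le[of z y] y by (simp add: dist_real_def)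
  then have "a / 2 * \<eta> k \<le> snd y"
    using cube_height[OF assms] by linarith
  with 1 show "y \<in> enlarged k" by (simp add: enlarged_def)
qed

lemma enlarged_height:
  assumes "z \<in> enlarged k"
  shows "a / 2 * \<eta> k \<le> snd z" "snd z \<le> (1 + spread) * \<eta> k"
proof -
  show "a / 2 * \<eta> k \<le> snd z" using assms by (simp add: enlarged_def)
  have "\<bar>\<eta> k - snd z\<bar> \<le> spread * \<eta> k"
    using dist_snd_le[of "(\<xi> k, \<eta> k)" z] assms by (simp add: enlarged_def dist_real_def)
  then show "snd z \<le> (1 + spread) * \<eta> k"
    by (simp add: algebra_simps abs_le_iff)
qed

lemma enlarged_subset: "enlarged k \<subseteq> upper_half_space"
proof
  fix z assume "z \<in> enlarged k"
  then have "a / 2 * \<eta> k \<le> snd z" by (rule enlarged_height)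
  moreover have "0 < a / 2 * \<eta> k" using a height_pos by simp
  ultimately show "z \<in> upper_half_space"
    unfolding upper_half_space_def by simp
qed

lemma closed_enlarged: "closed (enlarged k)"
  unfolding enlarged_def by (intro closed_Int closed_cball closed_Collect_le continuous_intros)

lemma enlarged_weight:
  shows "\<exists>c>0. \<forall>k z. z \<in> enlarged k \<longrightarrow> c * \<eta> k powr \<beta> \<le> snd z powr \<beta>"
proof (intro exI conjI allI impI)
  \<comment> \<open>\<open>snd z / \<eta> k\<close> ranges between \<open>a / 2\<close> and
    \<open>1 + spread\<close>; which end minimizes the power depends on the sign of
    \<open>\<beta>\<close>.\<close>
  let ?c = "min ((a / 2) powr \<beta>) ((1 + spread) powr \<beta>)"
  show "0 < ?c" using a spread_pos by simp
  fix k z assume z: "z \<in> enlarged k"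
  define u where "u = snd z / \<eta> k"
  have u: "a / 2 \<le> u" "u \<le> 1 + spread"
    using enlarged_height[OF z] height_pos[of k] by (simp_all add: u_def field_simps)
  have "?c \<le> u powr \<beta>"
  proof (cases "0 \<le> \<beta>")
    case True
    then have "(a / 2) powr \<beta> \<le> u powr \<beta>" using u a by (intro powr_mono2) auto
    then show ?thesis by simp
  next
    case False
    then have "(1 + spread) powr \<beta> \<le> u powr \<beta>" using u a by (intro powr_mono2') auto
    then show ?thesis by simp
  qed
  then have "?c * \<eta> k powr \<beta> \<le> u powr \<beta> * \<eta> k powr \<beta>"
    by (intro mult_right_mono) auto
  also have "\<dots> = (u * \<eta> k) powr \<beta>"
    using u a height_pos[of k] by (simp add: powr_mult)
  also have "u * \<eta> k = snd z"
    using height_pos[of k] by (simp add: u_def)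
  finally show "?c * \<eta> k powr \<beta> \<le> snd z powr \<beta>" .
qed

text \<open>Every cube whose enlargement contains \<open>w\<close> has size comparable to the height of \<open>w\<close> and lies
  in a ball around \<open>w\<close> of comparable radius, so the overlap is bounded by comparing volumes.\<close>

lemma bounded_overlap: "\<exists>C>0. \<forall>w n. real (card {k. k < n \<and> w \<in> enlarged k}) \<le> C"
proof -
  let ?N = "DIM((real^'n) \<times> real)"
  define V where "V = unit_ball_vol (real ?N)"
  have V: "0 < V" by (simp add: V_def)
  \<comment> \<open>If \<open>w\<close> has height \<open>\<tau>\<close> and lies in
    \<open>enlarged k\<close>, then \<open>cube k\<close> has edge at least
    \<open>p * \<tau>\<close> and its interior lies in \<open>cball w (r * \<tau>)\<close>. The
    powers of \<open>\<tau>\<close> cancel when volumes are compared. Interiors are used because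
    closed cubes may share faces, and the cutoff \<open>k < n\<close> makes the counted set finite
    from the outset.\<close>
  define p where "p = a / (1 + spread)"
  define r where "r = 2 * spread * (2 / a)"
  have p: "0 < p" and r: "0 < r" using a spread_pos by (simp_all add: p_def r_def)
  show ?thesis
  proof (intro exI[of _ "V * r ^ ?N / p ^ ?N"] conjI allI)
    show "0 < V * r ^ ?N / p ^ ?N" using V p r by simp
    fix w :: "(real^'n) \<times> real" and n :: nat
    define F where "F = {k. k < n \<and> w \<in> enlarged k}"
    have "finite F" by (simp add: F_def)
    show "real (card {k. k < n \<and> w \<in> enlarged k}) \<le> V * r ^ ?N / p ^ ?N"
    proof (cases "F = {}")
      case True
      then have "{k. k < n \<and> w \<in> enlarged k} = {}" unfolding F_def .
      then show ?thesis using V p r by (simp only: card.empty) simp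
    next
      case False
      then obtain k0 where k0: "w \<in> enlarged k0" by (auto simp: F_def)
      define \<tau> where "\<tau> = snd w"
      have \<tau>: "0 < \<tau>" using enlarged_subset[of k0] k0 by (auto simp: \<tau>_def upper_half_space_def)
      have size: "\<eta> k \<le> \<tau> * (2 / a)" "p * \<tau> \<le> l k" if "k \<in> F" for k
      proof -
        have w: "w \<in> enlarged k" using that by (simp add: F_def)
        show "\<eta> k \<le> \<tau> * (2 / a)"
          using enlarged_height(1)[OF w] a by (simp add: \<tau>_def field_simps)
        have "p * \<tau> \<le> p * ((1 + spread) * \<eta> k)"
          using enlarged_height(2)[OF w] p by (simp add: \<tau>_def)
        also have "\<dots> = a * \<eta> k" using spread_pos by (simp add: p_def)
        finally show "p * \<tau> \<le> l k" using edge_lower[of k] by linarith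
      qed
      have sub: "interior (cube k) \<subseteq> cball w (r * \<tau>)" if k: "k \<in> F" for k
      proof
        fix y assume "y \<in> interior (cube k)"
        then have y: "y \<in> cube k" using interior_subset by blast
        have "dist w y \<le> dist (\<xi> k, \<eta> k) w + dist y (\<xi> k, \<eta> k)"
          by (metis add.commute dist_commute dist_triangle)
        also have "\<dots> \<le> spread * \<eta> k + b * norm (One :: (real^'n) \<times> real) * \<eta> k"
          using k cube_dist[OF y] by (simp add: F_def enlarged_def add_mono)
        also have "\<dots> \<le> 2 * spread * \<eta> k"
          using a height_pos[of k] by (simp add: spread_def algebra_simps)
        also have "\<dots> \<le> 2 * spread * (\<tau> * (2 / a))"
          using size(1)[OF k] spread_pos by (intro mult_left_mono) auto
        finally show "y \<in> cball w (r * \<tau>)" by (simp add: r_def mult_ac)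
      qed
      have "ennreal (real (card F) * (p * \<tau>) ^ ?N) = (\<Sum>k\<in>F. ennreal ((p * \<tau>) ^ ?N))"
        using p \<tau> by (simp add: ennreal_mult ennreal_of_nat_eq_real_of_nat)
      also have "\<dots> \<le> (\<Sum>k\<in>F. emeasure lborel (interior (cube k)))"
      proof (rule sum_mono)
        fix k assume "k \<in> F"
        then have "(p * \<tau>) ^ ?N \<le> l k ^ ?N"
          using size(2) p \<tau> by (intro power_mono) auto
        then show "ennreal ((p * \<tau>) ^ ?N) \<le> emeasure lborel (interior (cube k))"
          unfolding cube_def emeasure_interior_closed_cube[OF edge_pos] by (rule ennreal_leI)
      qed
      also have "\<dots> = emeasure lborel (\<Union>k\<in>F. interior (cube k))"
        using \<open>finite F\<close> disjoint
        by (intro sum_emeasure) (auto simp: disjoint_family_on_def cube_def)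
      also have "\<dots> \<le> emeasure lborel (cball w (r * \<tau>))"
        using sub by (intro emeasure_mono) auto
      also have "\<dots> = ennreal (V * (r * \<tau>) ^ ?N)"
        using r \<tau> by (simp add: emeasure_cball V_def)
      finally have "real (card F) * (p * \<tau>) ^ ?N \<le> V * (r * \<tau>) ^ ?N"
        using V r \<tau> by (subst (asm) ennreal_le_iff) auto
      then have "(real (card F) * p ^ ?N) * \<tau> ^ ?N \<le> (V * r ^ ?N) * \<tau> ^ ?N"
        by (simp only: power_mult_distrib mult_ac)
      then have "real (card F) * p ^ ?N \<le> V * r ^ ?N"
        by (rule mult_right_le_imp_le) (use \<tau> in simp)
      then show ?thesis
        using p unfolding F_def by (simp add: field_simps)
    qed
  qed
qed

text \<open>Integrate the overlap bound against \<open>g\<close>. That bound is uniform in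
  \<open>n\<close>, so it passes from partial sums to the series.\<close>

lemma suminf_nn_integral_enlarged_le:
  "\<exists>C>0. \<forall>g. (\<lambda>z. g z * indicator upper_half_space z) \<in> borel_measurable borel \<longrightarrow>
     (\<Sum>k. \<integral>\<^sup>+z\<in>enlarged k. g z \<partial>lborel) \<le> ennreal C * (\<integral>\<^sup>+z\<in>upper_half_space. g z \<partial>lborel)"
proof -
  obtain C where C: "C > 0" "\<And>w n. real (card {k. k < n \<and> w \<in> enlarged k}) \<le> C"
    using bounded_overlap by blast
  show ?thesis
  proof (intro exI[of _ C] conjI allI impI C(1))
    fix g :: "(real^'n) \<times> real \<Rightarrow> ennreal"
    let ?h = "\<lambda>z. g z * indicator upper_half_space z"
    assume h: "?h \<in> borel_measurable borel"
    have ind: "(indicator (enlarged k) :: _ \<Rightarrow> ennreal) \<in> borel_measurable borel" for k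
      by (intro borel_measurable_indicator borel_closed closed_enlarged)
    have eq: "g z * indicator (enlarged k) z = ?h z * indicator (enlarged k) z" for k z
      using enlarged_subset[of k] by (auto simp: indicator_def)
    show "(\<Sum>k. \<integral>\<^sup>+z\<in>enlarged k. g z \<partial>lborel) \<le> ennreal C * (\<integral>\<^sup>+z. ?h z \<partial>lborel)"
    proof (rule suminf_le_const[OF summableI])
      fix n
      have "(\<Sum>k<n. \<integral>\<^sup>+z\<in>enlarged k. g z \<partial>lborel) = (\<integral>\<^sup>+z. (\<Sum>k<n. ?h z * indicator (enlarged k) z) \<partial>lborel)"
        unfolding eq using h ind by (intro nn_integral_sum[symmetric]) (auto intro!: borel_measurable_times_ennreal)
      also have "\<dots> \<le> (\<integral>\<^sup>+z. ennreal C * ?h z \<partial>lborel)"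
      proof (rule nn_integral_mono)
        fix z
        have "(\<Sum>k<n. indicator (enlarged k) z :: ennreal) = of_nat (card {k. k < n \<and> z \<in> enlarged k})"
        proof -
          have "{..<n} \<inter> {k. z \<in> enlarged k} = {k. k < n \<and> z \<in> enlarged k}" by auto
          then show ?thesis by (simp add: indicator_def sum.If_cases)
        qed
        also have "\<dots> \<le> ennreal C"
          using C(2)[of n z] C(1) by (simp add: ennreal_of_nat_eq_real_of_nat ennreal_leI)
        finally have "(\<Sum>k<n. indicator (enlarged k) z) * ?h z \<le> ennreal C * ?h z"
          by (rule mult_right_mono) simp
        then show "(\<Sum>k<n. ?h z * indicator (enlarged k) z) \<le> ennreal C * ?h z"
          by (simp only: sum_distrib_left[symmetric] mult.commute)
      qed
      also have "\<dots> = ennreal C * (\<integral>\<^sup>+z. ?h z \<partial>lborel)"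
        using h by (intro nn_integral_cmult) auto
      finally show "(\<Sum>k<n. \<integral>\<^sup>+z\<in>enlarged k. g z \<partial>lborel) \<le> ennreal C * (\<integral>\<^sup>+z. ?h z \<partial>lborel)" .
    qed
  qed
qed

text \<open>The mean value bound on a ball of radius \<open>a / 2 * \<eta> k\<close> costs
  \<open>\<eta> k\<close> to the power \<open>- (CARD('n) + 1)\<close>. Inserting the weight, which
  is bounded below by a multiple of \<open>\<eta> k powr \<beta>\<close> on
  \<open>enlarged k\<close>, costs the remaining exponent \<open>- \<beta>\<close>.\<close>

lemma local_estimate:
  assumes s: "0 < s"
  shows "\<exists>C>0. \<forall>k f z. harmonic_on f upper_half_space \<longrightarrow> z \<in> cube k \<longrightarrow>
    ennreal (\<bar>f z\<bar> powr s) \<le> ennreal (C * \<eta> k powr - (real CARD('n) + 1 + \<beta>)) *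
      (\<integral>\<^sup>+y\<in>enlarged k. ennreal (\<bar>f y\<bar> powr s * snd y powr \<beta>) \<partial>lborel)"
proof -
  let ?N = "DIM((real^'n) \<times> real)"
  obtain C where C: "C > 0" and mean: "\<And>f S (z::(real^'n) \<times> real) r.
     harmonic_on f S \<Longrightarrow> 0 < r \<Longrightarrow> cball z r \<subseteq> S \<Longrightarrow>
     ennreal (\<bar>f z\<bar> powr s) \<le> ennreal (C / r ^ ?N) * (\<integral>\<^sup>+y\<in>cball z r. ennreal (\<bar>f y\<bar> powr s) \<partial>lborel)"
    using harmonic_power_mean_bound[OF s, where 'a = "(real^'n) \<times> real"] by blast
  obtain c where c: "c > 0" "\<And>k z. z \<in> enlarged k \<Longrightarrow> c * \<eta> k powr \<beta> \<le> snd z powr \<beta>"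
    using enlarged_weight by blast
  define C' where "C' = C / ((a / 2) ^ ?N * c)"
  show ?thesis
  proof (intro exI[of _ C'] conjI allI impI)
    show "0 < C'" using C c a by (simp add: C'_def)
    fix k and f :: "(real^'n) \<times> real \<Rightarrow> real" and z :: "(real^'n) \<times> real"
    assume f: "harmonic_on f upper_half_space" and z: "z \<in> cube k"
    let ?r = "a / 2 * \<eta> k"
    have r: "0 < ?r" using a height_pos by simp
    have fc: "continuous_on (enlarged k) f"
      using harmonic_on_continuous(1)[OF f] enlarged_subset by (rule continuous_on_subset)
    have "0 < snd y" if "y \<in> enlarged k" for y
      using that enlarged_subset[of k] by (auto simp: upper_half_space_def)
    then have m: "(\<lambda>y. ennreal (\<bar>f y\<bar> powr s * snd y powr \<beta>) * indicator (enlarged k) y) \<in> borel_measurable borel"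
      using s closed_enlarged
      by (intro borel_measurable_ennreal_indicator continuous_on_mult continuous_on_powr' continuous_intros fc borel_closed)
        (auto simp: less_imp_le less_imp_neq[symmetric])
    have "ennreal (\<bar>f z\<bar> powr s) \<le> ennreal (C / ?r ^ ?N) * (\<integral>\<^sup>+y\<in>cball z ?r. ennreal (\<bar>f y\<bar> powr s) \<partial>lborel)"
      using cball_subset_enlarged[OF z] enlarged_subset by (intro mean[OF f r]) blast
    also have "(\<integral>\<^sup>+y\<in>cball z ?r. ennreal (\<bar>f y\<bar> powr s) \<partial>lborel) \<le>
      (\<integral>\<^sup>+y. ennreal (1 / (c * \<eta> k powr \<beta>)) * (ennreal (\<bar>f y\<bar> powr s * snd y powr \<beta>) * indicator (enlarged k) y) \<partial>lborel)"
    proof (rule nn_integral_mono)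
      fix y
      show "ennreal (\<bar>f y\<bar> powr s) * indicator (cball z ?r) y \<le>
        ennreal (1 / (c * \<eta> k powr \<beta>)) * (ennreal (\<bar>f y\<bar> powr s * snd y powr \<beta>) * indicator (enlarged k) y)"
      proof (cases "y \<in> cball z ?r")
        case True
        then have y: "y \<in> enlarged k" using cball_subset_enlarged[OF z] by blast
        have pos: "0 < c * \<eta> k powr \<beta>" using c height_pos[of k] by simp
        have "\<bar>f y\<bar> powr s * (c * \<eta> k powr \<beta>) \<le> \<bar>f y\<bar> powr s * snd y powr \<beta>"
          by (intro mult_left_mono c(2) y) simp
        then have "\<bar>f y\<bar> powr s \<le> 1 / (c * \<eta> k powr \<beta>) * (\<bar>f y\<bar> powr s * snd y powr \<beta>)"
          using pos by (simp add: pos_le_divide_eq)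
        then have "ennreal (\<bar>f y\<bar> powr s) \<le> ennreal (1 / (c * \<eta> k powr \<beta>) * (\<bar>f y\<bar> powr s * snd y powr \<beta>))"
          by (rule ennreal_leI)
        also have "\<dots> = ennreal (1 / (c * \<eta> k powr \<beta>)) * ennreal (\<bar>f y\<bar> powr s * snd y powr \<beta>)"
          using pos by (intro ennreal_mult) auto
        finally show ?thesis using True y by simp
      qed simp
    qed
    also have "\<dots> = ennreal (1 / (c * \<eta> k powr \<beta>)) *
       (\<integral>\<^sup>+y\<in>enlarged k. ennreal (\<bar>f y\<bar> powr s * snd y powr \<beta>) \<partial>lborel)"
      using m by (intro nn_integral_cmult) simp
    finally have "ennreal (\<bar>f z\<bar> powr s) \<le> ennreal (C / ?r ^ ?N) * (ennreal (1 / (c * \<eta> k powr \<beta>)) *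
       (\<integral>\<^sup>+y\<in>enlarged k. ennreal (\<bar>f y\<bar> powr s * snd y powr \<beta>) \<partial>lborel))"
      by (simp add: mult_left_mono)
    also have "\<dots> = ennreal (C / ?r ^ ?N * (1 / (c * \<eta> k powr \<beta>))) *
       (\<integral>\<^sup>+y\<in>enlarged k. ennreal (\<bar>f y\<bar> powr s * snd y powr \<beta>) \<partial>lborel)"
    proof -
      have "ennreal u * (ennreal v * I) = ennreal (u * v) * I" if "0 \<le> u" "0 \<le> v" for u v I
        using that by (simp add: ennreal_mult mult.assoc)
      then show ?thesis
        using C r c height_pos[of k] by simp
    qed
    also have "C / ?r ^ ?N * (1 / (c * \<eta> k powr \<beta>)) = C' * \<eta> k powr - (real CARD('n) + 1 + \<beta>)"
    proof -
      have "\<eta> k powr (real CARD('n) + 1 + \<beta>) = \<eta> k ^ ?N * \<eta> k powr \<beta>"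
        using height_pos[of k] by (simp add: powr_add powr_realpow mult.commute)
      then show ?thesis
        using height_pos[of k] a c unfolding C'_def powr_minus_divide power_mult_distrib
        by (simp add: mult_ac)
    qed
    finally show "ennreal (\<bar>f z\<bar> powr s) \<le> ennreal (C' * \<eta> k powr - (real CARD('n) + 1 + \<beta>)) *
       (\<integral>\<^sup>+y\<in>enlarged k. ennreal (\<bar>f y\<bar> powr s * snd y powr \<beta>) \<partial>lborel)" .
  qed
qed

end

text \<open>The distance from a cube to the boundary is exactly the height
  \<open>\<eta> k - l k / 2\<close> of its bottom face, and its diameter is a fixed multiple of its
  edge, so the Whitney inequalities become linear inequalities between \<open>l k\<close> and
  \<open>\<eta> k\<close>.\<close>

lemma whitney_decomposition_cubes:
  fixes \<xi> :: "nat \<Rightarrow> real^'n"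
  assumes "whitney_decomposition \<Delta> (\<lambda>k. (\<xi> k, \<eta> k))"
  obtains l a b where "whitney_cubes \<xi> \<eta> l a b" "\<And>k. \<Delta> k = closed_cube (\<xi> k, \<eta> k) (l k)"
proof -
  let ?H = "upper_half_space :: ((real^'n) \<times> real) set"
  let ?o = "norm (One :: (real^'n) \<times> real)"
  note W = assms[unfolded whitney_decomposition_def]
  from W have "\<exists>l. \<forall>k. 0 < l k \<and> \<Delta> k = closed_cube (\<xi> k, \<eta> k) (l k)"
    by (elim conjE)
  then obtain l where l: "\<And>k. 0 < l k" and \<Delta>: "\<And>k. \<Delta> k = closed_cube (\<xi> k, \<eta> k) (l k)"
    by auto
  from W have "\<exists>c>0. \<exists>C>0. \<forall>k. c * setdist (\<Delta> k) (frontier ?H) \<le> diameter (\<Delta> k) \<and>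
      diameter (\<Delta> k) \<le> C * setdist (\<Delta> k) (frontier ?H)"
    by (elim conjE)
  then obtain c C where c: "0 < c" "\<And>k. c * setdist (\<Delta> k) (frontier ?H) \<le> diameter (\<Delta> k)"
    and C: "0 < C" "\<And>k. diameter (\<Delta> k) \<le> C * setdist (\<Delta> k) (frontier ?H)"
    by auto
  have sub: "\<Delta> k \<subseteq> ?H" and disj: "j \<noteq> k \<Longrightarrow> interior (\<Delta> j) \<inter> interior (\<Delta> k) = {}" for j k
    using assms unfolding whitney_decomposition_def by blast+
  have diam: "diameter (\<Delta> k) = l k * ?o" for k
    unfolding \<Delta> by (rule diameter_closed_cube[OF l])
  have bot: "(\<xi> k, \<eta> k - l k / 2) \<in> \<Delta> k" for k
    unfolding \<Delta> closed_cube_edges[OF l] using l[of k] by (auto simp: Basis_prod_def inner_prod_def)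
  have h: "0 < \<eta> k - l k / 2" for k
    using sub[of k] bot[of k] by (auto simp: upper_half_space_def)
  then have \<eta>: "0 < \<eta> k" for k
    using l[of k] by (smt (verit) divide_nonneg_nonneg)
  have fr: "(\<xi> k, 0) \<in> frontier ?H" for k
    by (simp add: frontier_upper_half_space)
  have up: "setdist (\<Delta> k) (frontier ?H) \<le> \<eta> k - l k / 2" for k
    using setdist_le_dist[OF bot[of k] fr[of k]] h[of k] by (simp add: dist_Pair_Pair dist_real_def)
  have low: "\<eta> k - l k / 2 \<le> setdist (\<Delta> k) (frontier ?H)" for k
  proof -
    have "\<eta> k - l k / 2 \<le> dist x y" if x: "x \<in> \<Delta> k" and y: "y \<in> frontier ?H" for x y
    proof -
      have "\<bar>(x - (\<xi> k, \<eta> k)) \<bullet> (0, 1)\<bar> \<le> l k / 2"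
        using x unfolding \<Delta> closed_cube_edges[OF l] by (simp add: Basis_prod_def)
      moreover have "(x - (\<xi> k, \<eta> k)) \<bullet> (0, 1) = snd x - \<eta> k"
        by (simp add: inner_prod_def)
      ultimately have "\<eta> k - l k / 2 \<le> snd x"
        by linarith
      also have "snd x \<le> dist x y"
        using dist_snd_le[of x y] y by (simp add: frontier_upper_half_space dist_real_def)
      finally show ?thesis .
    qed
    then show ?thesis
      using bot[of k] fr[of k] by (subst le_setdist_iff) blast
  qed
  have o: "0 < ?o"
    using one_le_norm_One[where 'a = "(real^'n) \<times> real"] by linarith
  \<comment> \<open>The upper Whitney inequality reads
    \<open>l k \<le> b * (\<eta> k - l k / 2)\<close>, hence the bottom face is at least at the
    fraction \<open>1 / (1 + b / 2)\<close> of the height of the center. \<open>a\<close> is the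
    smaller of this fraction and of its product with the constant \<open>c / ?o\<close> from the
    lower inequality.\<close>
  define b where "b = C / ?o"
  define a where "a = min (1 / (1 + b / 2)) (c / ?o / (1 + b / 2))"
  have b: "0 < b" using C o by (simp add: b_def)
  have a: "0 < a" using c o b by (simp add: a_def)
  have l_le: "l k \<le> b * (\<eta> k - l k / 2)" for k
  proof -
    have "l k * ?o \<le> C * (\<eta> k - l k / 2)"
      using C(2)[of k] mult_left_mono[OF up[of k], of C] C(1) unfolding diam by linarith
    then show ?thesis using o by (simp add: b_def field_simps)
  qed
  have height: "\<eta> k \<le> (1 + b / 2) * (\<eta> k - l k / 2)" for k
    using l_le[of k] by (simp add: algebra_simps)
  have bottom: "\<eta> k / (1 + b / 2) \<le> \<eta> k - l k / 2" for k
    using height[of k] b by (simp add: pos_divide_le_eq mult.commute)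
  show thesis
  proof (rule that[OF _ \<Delta>])
    show "whitney_cubes \<xi> \<eta> l a b"
    proof
      fix k
      have "a * \<eta> k \<le> 1 / (1 + b / 2) * \<eta> k"
        unfolding a_def using \<eta>[of k] by (intro mult_right_mono) auto
      then show "a * \<eta> k \<le> \<eta> k - l k / 2"
        using bottom[of k] by simp
      have "c * (\<eta> k - l k / 2) \<le> l k * ?o"
        using c(2)[of k] mult_left_mono[OF low[of k], of c] c(1) unfolding diam by linarith
      then have 1: "c / ?o * (\<eta> k - l k / 2) \<le> l k"
        using o by (simp add: pos_divide_le_eq)
      have "a * \<eta> k \<le> c / ?o / (1 + b / 2) * \<eta> k"
        unfolding a_def using \<eta>[of k] by (intro mult_right_mono) auto
      also have "\<dots> = c / ?o * (\<eta> k / (1 + b / 2))" by simp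
      also have "\<dots> \<le> c / ?o * (\<eta> k - l k / 2)"
        using bottom[of k] c o by (intro mult_left_mono) auto
      finally show "a * \<eta> k \<le> l k" using 1 by linarith
      have "b * (\<eta> k - l k / 2) \<le> b * \<eta> k"
        using b l[of k] by (intro mult_left_mono) auto
      then show "l k \<le> b * \<eta> k" using l_le[of k] by linarith
      show "interior (closed_cube (\<xi> j, \<eta> j) (l j)) \<inter> interior (closed_cube (\<xi> k, \<eta> k) (l k)) = {}"
        if "j \<noteq> k" for j
        using disj[OF that] unfolding \<Delta> .
    qed (use a b \<eta> in auto)
  qed
qed

section \<open>The embedding theorem\<close>

lemma ennreal_powr_leD:
  assumes "ennreal_powr x a \<le> ennreal y" "0 < a" "0 \<le> y"
  shows "x \<le> ennreal (y powr (1 / a))"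
proof (cases x)
  case (real u)
  then have "u powr a \<le> y"
    using assms by (simp add: ennreal_powr_ennreal)
  then have "(u powr a) powr (1 / a) \<le> y powr (1 / a)"
    using assms by (intro powr_mono2) auto
  then show ?thesis
    using real assms by (simp add: powr_powr ennreal_leI)
next
  case top
  then show ?thesis using assms by (simp add: top_unique)
qed

text \<open>This is how \<open>q / s \<ge> 1\<close> is exploited: an \<open>r\<close>-th power of a
  local integral becomes linear in it, at the cost of a power of the global integral, and linear
  terms can be summed over the cubes.\<close>

lemma powr_le_powr_minus_one_mult:
  fixes x y r :: real
  assumes "0 \<le> x" "x \<le> y" "1 \<le> r"
  shows "x powr r \<le> y powr (r - 1) * x"
proof (cases "x = 0")
  case False
  then have "x powr r = x powr (r - 1) * x"
    using assms powr_mult_base[of x "r - 1"] by (simp add: mult.commute)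
  also have "\<dots> \<le> y powr (r - 1) * x"
    using assms by (intro mult_right_mono powr_mono2) auto
  finally show ?thesis .
qed simp

lemma prod_powr_eq:
  fixes f :: "'b \<Rightarrow> real"
  assumes "\<And>i. i \<in> A \<Longrightarrow> 0 \<le> f i"
  shows "(\<Prod>i\<in>A. f i) powr a = (\<Prod>i\<in>A. f i powr a)"
  using assms by (induction A rule: infinite_finite_induct) (simp_all add: powr_mult prod_nonneg)

section \<open>The two implications for a fixed family of cubes\<close>

context whitney_cubes
begin

lemma cube_sets:
  assumes "sets \<mu> = sets (restrict_space borel upper_half_space)"
  shows "cube k \<in> sets \<mu>"
proof -
  have "cube k \<subseteq> upper_half_space"
  proof
    fix z assume "z \<in> cube k"
    then have "a * \<eta> k \<le> snd z" by (rule cube_height)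
    moreover have "0 < a * \<eta> k" using a height_pos by simp
    ultimately show "z \<in> upper_half_space" by (simp add: upper_half_space_def)
  qed
  moreover have "cube k \<in> sets borel"
    by (simp add: cube_def closed_cube_def)
  ultimately show ?thesis
    unfolding assms using borel_open[OF open_upper_half_space] by (subst sets_restrict_space_iff) auto
qed

text \<open>For each \<open>k\<close>, insert the test function adapted to \<open>cube k\<close> in
  all \<open>m\<close> slots and discard every term of the mixed norm but the \<open>k\<close>-th.
  The lower bound of the test function on the cube then turns that term into a bound for the
  measure.\<close>

lemma embedding_imp_measure_bound:
  assumes p: "0 < p" and q: "0 < q" and s: "0 < s"
    and \<beta>: "\<forall>i\<in>{1..m}. -1 < \<beta> i"
    and sets: "sets \<mu> = sets (restrict_space borel upper_half_space)"
    and C: "0 < C"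
    and bound: "\<forall>f. (\<forall>i\<in>{1..m}. f i \<in> bergman_space s (\<beta> i)) \<longrightarrow>
      mixed_norm cube p q m \<mu> f \<le> ennreal C * (\<Prod>i=1..m. bergman_norm s (\<beta> i) (f i))"
  shows "\<exists>D>0. \<forall>k. emeasure \<mu> (cube k) \<le>
    ennreal (D * \<eta> k powr (\<Sum>i=1..m. p * (real CARD('n) + 1 + \<beta> i) / s))"
proof -
  \<comment> \<open>The distance from a point of the cube to \<open>(\<xi> k, 0)\<close> is at most
    its distance to the center plus \<open>\<eta> k\<close>.\<close>
  define T where "T = b * norm (One :: (real^'n) \<times> real) + 1"
  have T: "0 < T" using b by (simp add: T_def add_nonneg_pos)
  obtain c M :: real and L :: "nat \<Rightarrow> real" and F :: "real^'n \<Rightarrow> real \<Rightarrow> (real^'n) \<times> real \<Rightarrow> real"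
    where c: "0 < c" and L: "\<And>i. i \<in> {1..m} \<Longrightarrow> 0 < L i"
    and F: "\<And>i \<xi> \<eta>. i \<in> {1..m} \<Longrightarrow> 0 < \<eta> \<Longrightarrow> F \<xi> \<eta> \<in> bergman_space s (\<beta> i)"
    and F_norm: "\<And>i \<xi> \<eta>. i \<in> {1..m} \<Longrightarrow> 0 < \<eta> \<Longrightarrow> bergman_norm s (\<beta> i) (F \<xi> \<eta>) \<le>
           ennreal (L i * \<eta> powr ((real CARD('n) + 1 + \<beta> i) / s - M))"
    and F_lower: "\<And>\<xi> \<eta> z. 0 < \<eta> \<Longrightarrow> norm (z - (\<xi>, 0)) \<le> T * \<eta> \<Longrightarrow> c * \<eta> powr - M \<le> F \<xi> \<eta> z"
    by (rule bergman_test_functions[OF s T bspec[OF \<beta>]]) blast+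
  define P where "P = (\<Prod>i=1..m. L i)"
  have P: "0 < P" unfolding P_def using L by (intro prod_pos) auto
  define D where "D = (C * P) powr p / (c powr p) ^ m"
  show ?thesis
  proof (intro exI[of _ D] conjI allI)
    show "0 < D" using C P c by (simp add: D_def)
    fix k
    let ?e = "\<lambda>i. (real CARD('n) + 1 + \<beta> i) / s"
    note h = height_pos[of k]
    define Y where "Y = C * (P * \<eta> k powr (\<Sum>i=1..m. ?e i - M))"
    have Y: "0 < Y" using C P h by (simp add: Y_def)
    let ?I = "\<integral>\<^sup>+z\<in>cube k. ennreal (\<Prod>i=1..m. \<bar>F (\<xi> k) (\<eta> k) z\<bar> powr p) \<partial>\<mu>"
    let ?t = "\<lambda>j. ennreal_powr (\<integral>\<^sup>+z\<in>cube j. ennreal (\<Prod>i=1..m. \<bar>F (\<xi> k) (\<eta> k) z\<bar> powr p) \<partial>\<mu>) (q / p)"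
    have "mixed_norm cube p q m \<mu> (\<lambda>_. F (\<xi> k) (\<eta> k)) \<le>
        ennreal C * (\<Prod>i=1..m. bergman_norm s (\<beta> i) (F (\<xi> k) (\<eta> k)))"
      using F h by (intro bound[rule_format]) auto
    also have "\<dots> \<le> ennreal C * (\<Prod>i=1..m. ennreal (L i * \<eta> k powr (?e i - M)))"
      using F_norm h by (intro mult_left_mono prod_mono_ennreal) auto
    also have "(\<Prod>i=1..m. ennreal (L i * \<eta> k powr (?e i - M))) = ennreal (\<Prod>i=1..m. L i * \<eta> k powr (?e i - M))"
      using L by (intro prod_ennreal) (auto simp: less_imp_le)
    also have "(\<Prod>i=1..m. L i * \<eta> k powr (?e i - M)) = P * \<eta> k powr (\<Sum>i=1..m. ?e i - M)"
      using h by (simp add: P_def prod.distrib powr_sum)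
    also have "ennreal C * ennreal (P * \<eta> k powr (\<Sum>i=1..m. ?e i - M)) = ennreal Y"
      using C P by (simp add: Y_def ennreal_mult[symmetric])
    finally have "ennreal_powr (\<Sum>j. ?t j) (1 / q) \<le> ennreal Y"
      unfolding mixed_norm_def .
    from ennreal_powr_leD[OF this] have "(\<Sum>j. ?t j) \<le> ennreal (Y powr q)"
      using q Y by simp
    moreover have "?t k \<le> (\<Sum>j. ?t j)"
      using sum_le_suminf[of ?t "{k}"] by simp
    ultimately have "ennreal_powr ?I (q / p) \<le> ennreal (Y powr q)"
      by (rule order_trans[rotated])
    from ennreal_powr_leD[OF this] have "?I \<le> ennreal ((Y powr q) powr (1 / (q / p)))"
      using p q by simp
    also have "(Y powr q) powr (1 / (q / p)) = Y powr p"
      using q by (simp add: powr_powr)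
    finally have I: "?I \<le> ennreal (Y powr p)" .
    \<comment> \<open>The lower bound on the cube for the product of the \<open>p\<close>-th powers
      of the \<open>m\<close> equal functions.\<close>
    define w where "w = ((c * \<eta> k powr - M) powr p) ^ m"
    have w: "0 < w" using c h by (simp add: w_def)
    have "ennreal w * emeasure \<mu> (cube k) = (\<integral>\<^sup>+z\<in>cube k. ennreal w \<partial>\<mu>)"
      using cube_sets[OF sets] by (simp add: nn_integral_cmult_indicator)
    also have "\<dots> \<le> ?I"
    proof (rule nn_integral_mono)
      fix z
      show "ennreal w * indicator (cube k) z \<le> ennreal (\<Prod>i=1..m. \<bar>F (\<xi> k) (\<eta> k) z\<bar> powr p) * indicator (cube k) z"
      proof (cases "z \<in> cube k")
        case True
        have "norm (z - (\<xi> k, 0)) \<le> norm (z - (\<xi> k, \<eta> k)) + norm ((\<xi> k, \<eta> k) - (\<xi> k, 0 :: real))"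
          using norm_triangle_ineq[of "z - (\<xi> k, \<eta> k)" "(\<xi> k, \<eta> k) - (\<xi> k, 0)"]
          by (simp only: add_diff_eq diff_add_cancel)
        also have "\<dots> \<le> b * norm (One :: (real^'n) \<times> real) * \<eta> k + \<eta> k"
          using cube_dist[OF True] h by (simp add: dist_norm norm_Pair)
        also have "\<dots> = T * \<eta> k" by (simp add: T_def algebra_simps)
        finally have "c * \<eta> k powr - M \<le> F (\<xi> k) (\<eta> k) z"
          by (rule F_lower[OF h])
        then have "c * \<eta> k powr - M \<le> \<bar>F (\<xi> k) (\<eta> k) z\<bar>" by linarith
        then have "(c * \<eta> k powr - M) powr p \<le> \<bar>F (\<xi> k) (\<eta> k) z\<bar> powr p"
          using p c by (intro powr_mono2) auto
        then have "w \<le> (\<Prod>i=1..m. \<bar>F (\<xi> k) (\<eta> k) z\<bar> powr p)"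
          unfolding w_def by (simp add: power_mono)
        then show ?thesis by (intro mult_right_mono ennreal_leI) auto
      qed simp
    qed
    also note I
    finally have "ennreal (1 / w) * (ennreal w * emeasure \<mu> (cube k)) \<le> ennreal (1 / w) * ennreal (Y powr p)"
      by (rule mult_left_mono) simp
    then have "emeasure \<mu> (cube k) \<le> ennreal (Y powr p / w)"
      using w by (simp add: mult.assoc[symmetric] ennreal_mult[symmetric])
    also have "Y powr p / w = D * \<eta> k powr (\<Sum>i=1..m. p * (real CARD('n) + 1 + \<beta> i) / s)"
    proof -
      let ?E = "\<Sum>i=1..m. p * (real CARD('n) + 1 + \<beta> i) / s" and ?X = "- (M * p * real m)"
      \<comment> \<open>The power \<open>?X\<close> collects every occurrence of \<open>M\<close>.
        It appears in \<open>w\<close> and in \<open>Y powr p\<close> alike, so the order of decay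
        disappears from the quotient.\<close>
      have w_eq: "w = (c powr p) ^ m * \<eta> k powr ?X"
        using c h by (simp add: w_def powr_mult power_mult_distrib powr_powr powr_power mult_ac)
      have "(\<Sum>i=1..m. ?e i - M) * p = (\<Sum>i=1..m. p * (real CARD('n) + 1 + \<beta> i) / s - M * p)"
        unfolding sum_distrib_right by (rule sum.cong) (use s in \<open>simp_all add: field_simps\<close>)
      also have "\<dots> = ?E + ?X"
        by (simp add: sum_subtractf mult_ac)
      finally have e: "(\<Sum>i=1..m. ?e i - M) * p = ?E + ?X" .
      have "Y powr p = (C * P) powr p * \<eta> k powr ((\<Sum>i=1..m. ?e i - M) * p)"
        using C P h by (simp add: Y_def powr_mult powr_powr mult.assoc)
      also have "\<dots> = ((C * P) powr p * \<eta> k powr ?E) * \<eta> k powr ?X"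
        unfolding e powr_add by (simp only: mult.assoc)
      finally have Y_eq: "Y powr p = ((C * P) powr p * \<eta> k powr ?E) * \<eta> k powr ?X" .
      have nz: "\<eta> k powr ?X \<noteq> 0" using h by simp
      have "Y powr p / w = (C * P) powr p * \<eta> k powr ?E / (c powr p) ^ m"
        unfolding Y_eq w_eq by (rule mult_divide_mult_cancel_right[OF nz])
      then show ?thesis by (simp add: D_def)
    qed
    finally show "emeasure \<mu> (cube k) \<le> ennreal (D * \<eta> k powr (\<Sum>i=1..m. p * (real CARD('n) + 1 + \<beta> i) / s))" .
  qed
qed

text \<open>By \<open>local_estimate\<close> and the bound on the measure, the powers of
  \<open>\<eta> k\<close> cancel, and the \<open>k\<close>-th term is at most a constant times the
  product over \<open>i\<close> of the local integrals \<open>A k i\<close> to the power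
  \<open>r = q / s\<close>. Replacing all factors but the first by the global integrals
  \<open>J i\<close>, and all but one power of the first by \<open>J 1\<close>, leaves a sum that
  bounded overlap controls.\<close>

lemma measure_bound_imp_embedding:
  assumes p: "0 < p" and q: "0 < q" and s: "0 < s" "s \<le> q" and m: "1 \<le> m"
    and sets: "sets \<mu> = sets (restrict_space borel upper_half_space)"
    and D: "0 < D"
    and bound: "\<And>k. emeasure \<mu> (cube k) \<le>
      ennreal (D * \<eta> k powr (\<Sum>i=1..m. p * (real CARD('n) + 1 + \<beta> i) / s))"
  shows "\<exists>C>0. \<forall>f. (\<forall>i\<in>{1..m}. f i \<in> bergman_space s (\<beta> i)) \<longrightarrow>
      mixed_norm cube p q m \<mu> f \<le> ennreal C * (\<Prod>i=1..m. bergman_norm s (\<beta> i) (f i))"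
proof -
  let ?N = "real CARD('n) + 1"
  have "\<forall>i. \<exists>C>0. \<forall>k f z. harmonic_on f upper_half_space \<longrightarrow> z \<in> cube k \<longrightarrow>
    ennreal (\<bar>f z\<bar> powr s) \<le> ennreal (C * \<eta> k powr - (?N + \<beta> i)) *
      (\<integral>\<^sup>+y\<in>enlarged k. ennreal (\<bar>f y\<bar> powr s * snd y powr \<beta> i) \<partial>lborel)"
    using local_estimate[OF s(1)] by blast
  from choice[OF this] obtain B where *: "\<forall>i. 0 < B i \<and> (\<forall>k f z. harmonic_on f upper_half_space \<longrightarrow> z \<in> cube k \<longrightarrow>
    ennreal (\<bar>f z\<bar> powr s) \<le> ennreal (B i * \<eta> k powr - (?N + \<beta> i)) *
      (\<integral>\<^sup>+y\<in>enlarged k. ennreal (\<bar>f y\<bar> powr s * snd y powr \<beta> i) \<partial>lborel))"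
    by (rule exE)
  have B: "0 < B i" for i by (rule conjunct1[OF spec[OF *]])
  then have B_nz: "B i \<noteq> 0" for i by (rule less_imp_neq[symmetric])
  have local: "ennreal (\<bar>f z\<bar> powr s) \<le> ennreal (B i * \<eta> k powr - (?N + \<beta> i)) *
      (\<integral>\<^sup>+y\<in>enlarged k. ennreal (\<bar>f y\<bar> powr s * snd y powr \<beta> i) \<partial>lborel)"
    if "harmonic_on f upper_half_space" "z \<in> cube k" for i k f z
    using * that by blast
  obtain C0 where C0: "0 < C0" and overlap: "\<And>g. (\<lambda>z. g z * indicator upper_half_space z) \<in> borel_measurable borel \<Longrightarrow>
     (\<Sum>k. \<integral>\<^sup>+z\<in>enlarged k. g z \<partial>lborel) \<le> ennreal C0 * (\<integral>\<^sup>+z\<in>upper_half_space. g z \<partial>lborel)"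
    using suminf_nn_integral_enlarged_le by blast
  define r where "r = q / s"
  have r: "1 \<le> r" using s by (simp add: r_def)
  define P where "P = (\<Prod>i=1..m. B i powr (p / s))"
  have P: "0 < P" unfolding P_def using B_nz by (intro prod_pos) simp
  define P' where "P' = (P * D) powr (q / p)"
  have P': "0 < P'" using P D by (simp add: P'_def)
  define C where "C = (P' * C0) powr (1 / q)"
  show ?thesis
  proof (intro exI[of _ C] conjI allI impI)
    show "0 < C" using P' C0 by (simp add: C_def)
    fix f :: "nat \<Rightarrow> (real^'n) \<times> real \<Rightarrow> real"
    assume f: "\<forall>i\<in>{1..m}. f i \<in> bergman_space s (\<beta> i)"
    have harm: "harmonic_on (f i) upper_half_space" if "i \<in> {1..m}" for i
      using f that by (simp add: bergman_space_def)
    let ?g = "\<lambda>i z. ennreal (\<bar>f i z\<bar> powr s * snd z powr \<beta> i)"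
    have "\<forall>i\<in>{1..m}. \<exists>j\<ge>0. (\<integral>\<^sup>+z\<in>upper_half_space. ?g i z \<partial>lborel) = ennreal j \<and>
        bergman_norm s (\<beta> i) (f i) = ennreal (j powr (1 / s))"
    proof
      fix i assume "i \<in> {1..m}"
      then have "f i \<in> bergman_space s (\<beta> i)" using f by blast
      then obtain j where "0 \<le> j" "(\<integral>\<^sup>+z\<in>upper_half_space. ?g i z \<partial>lborel) = ennreal j"
        "bergman_norm s (\<beta> i) (f i) = ennreal (j powr (1 / s))"
        by (rule bergman_space_integral)
      then show "\<exists>j\<ge>0. (\<integral>\<^sup>+z\<in>upper_half_space. ?g i z \<partial>lborel) = ennreal j \<and>
        bergman_norm s (\<beta> i) (f i) = ennreal (j powr (1 / s))"
        by blast
    qed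
    from bchoice[OF this] obtain J where J_all: "\<forall>i\<in>{1..m}. 0 \<le> J i \<and>
        (\<integral>\<^sup>+z\<in>upper_half_space. ?g i z \<partial>lborel) = ennreal (J i) \<and>
        bergman_norm s (\<beta> i) (f i) = ennreal (J i powr (1 / s))"
      by (rule exE)
    have J: "0 \<le> J i" and J_int: "(\<integral>\<^sup>+z\<in>upper_half_space. ?g i z \<partial>lborel) = ennreal (J i)"
      and J_norm: "bergman_norm s (\<beta> i) (f i) = ennreal (J i powr (1 / s))" if "i \<in> {1..m}" for i
      using J_all that by blast+
    define A where "A k i = enn2real (\<integral>\<^sup>+z\<in>enlarged k. ?g i z \<partial>lborel)" for k i
    have A_nonneg: "0 \<le> A k i" for k i by (simp add: A_def)
    have A: "(\<integral>\<^sup>+z\<in>enlarged k. ?g i z \<partial>lborel) = ennreal (A k i)" "A k i \<le> J i" if i: "i \<in> {1..m}" for k i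
    proof -
      have "(\<integral>\<^sup>+z\<in>enlarged k. ?g i z \<partial>lborel) \<le> (\<integral>\<^sup>+z\<in>upper_half_space. ?g i z \<partial>lborel)"
        using enlarged_subset[of k] by (intro nn_integral_mono) (auto simp: indicator_def)
      then have le: "(\<integral>\<^sup>+z\<in>enlarged k. ?g i z \<partial>lborel) \<le> ennreal (J i)"
        unfolding J_int[OF i] .
      then show eq: "(\<integral>\<^sup>+z\<in>enlarged k. ?g i z \<partial>lborel) = ennreal (A k i)"
        unfolding A_def using le_less_trans[OF le ennreal_less_top] by (intro ennreal_enn2real[symmetric]) simp
      show "A k i \<le> J i"
        using le J[OF i] unfolding eq by simp
    qed
    have term_bound: "ennreal_powr (\<integral>\<^sup>+z\<in>cube k. ennreal (\<Prod>i=1..m. \<bar>f i z\<bar> powr p) \<partial>\<mu>) (q / p) \<le>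
        ennreal (P' * (\<Prod>i=1..m. A k i powr r))" for k
    proof -
      note h = height_pos[of k]
      let ?e = "\<lambda>i. p * (?N + \<beta> i) / s"
      let ?E = "\<Sum>i=1..m. ?e i"
      define Q where "Q = (\<Prod>i=1..m. A k i powr (p / s))"
      have Q: "0 \<le> Q" unfolding Q_def by (intro prod_nonneg) auto
      have point: "(\<Prod>i=1..m. \<bar>f i z\<bar> powr p) \<le> P * Q * \<eta> k powr - ?E" if z: "z \<in> cube k" for z
      proof -
        have "\<bar>f i z\<bar> powr p \<le> B i powr (p / s) * A k i powr (p / s) * \<eta> k powr - ?e i" if i: "i \<in> {1..m}" for i
        proof -
          have nn: "0 \<le> B i * \<eta> k powr - (?N + \<beta> i)" using B[of i] by simp
          have "ennreal (\<bar>f i z\<bar> powr s) \<le> ennreal (B i * \<eta> k powr - (?N + \<beta> i)) * ennreal (A k i)"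
            using local[OF harm[OF i] z, of i] unfolding A(1)[OF i] .
          also have "\<dots> = ennreal (B i * \<eta> k powr - (?N + \<beta> i) * A k i)"
            by (rule ennreal_mult[OF nn A_nonneg, symmetric])
          finally have "\<bar>f i z\<bar> powr s \<le> B i * \<eta> k powr - (?N + \<beta> i) * A k i"
            using mult_nonneg_nonneg[OF nn A_nonneg[of k i]] by (simp only: ennreal_le_iff)
          then have "(\<bar>f i z\<bar> powr s) powr (p / s) \<le> (B i * \<eta> k powr - (?N + \<beta> i) * A k i) powr (p / s)"
            using p s by (intro powr_mono2) auto
          also have "(\<bar>f i z\<bar> powr s) powr (p / s) = \<bar>f i z\<bar> powr p"
            using s by (simp add: powr_powr)
          also have "(B i * \<eta> k powr - (?N + \<beta> i) * A k i) powr (p / s) =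
              B i powr (p / s) * (\<eta> k powr - (?N + \<beta> i)) powr (p / s) * A k i powr (p / s)"
            using B[of i] A_nonneg[of k i] by (simp add: powr_mult)
          also have "(\<eta> k powr - (?N + \<beta> i)) powr (p / s) = \<eta> k powr - ?e i"
            unfolding powr_powr by (rule arg_cong[where f = "\<lambda>x. \<eta> k powr x"]) (use s in \<open>simp add: field_simps\<close>)
          finally show ?thesis by (simp add: mult_ac)
        qed
        then have "(\<Prod>i=1..m. \<bar>f i z\<bar> powr p) \<le> (\<Prod>i=1..m. B i powr (p / s) * A k i powr (p / s) * \<eta> k powr - ?e i)"
          by (intro prod_mono) auto
        also have "\<dots> = P * Q * \<eta> k powr - ?E"
          using h by (simp add: prod.distrib P_def Q_def powr_sum sum_negf[symmetric])
        finally show ?thesis .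
      qed
      have "(\<integral>\<^sup>+z\<in>cube k. ennreal (\<Prod>i=1..m. \<bar>f i z\<bar> powr p) \<partial>\<mu>) \<le> (\<integral>\<^sup>+z\<in>cube k. ennreal (P * Q * \<eta> k powr - ?E) \<partial>\<mu>)"
        using point by (intro nn_integral_mono) (auto simp: indicator_def intro!: ennreal_leI)
      also have "\<dots> = ennreal (P * Q * \<eta> k powr - ?E) * emeasure \<mu> (cube k)"
        by (rule nn_integral_cmult_indicator[OF cube_sets[OF sets]])
      also have "\<dots> \<le> ennreal (P * Q * \<eta> k powr - ?E) * ennreal (D * \<eta> k powr ?E)"
        by (intro mult_left_mono bound) simp
      also have "\<dots> = ennreal (P * Q * \<eta> k powr - ?E * (D * \<eta> k powr ?E))"
        using P Q D by (intro ennreal_mult[symmetric]) auto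
      also have "P * Q * \<eta> k powr - ?E * (D * \<eta> k powr ?E) = P * D * Q"
        using h by (simp add: powr_minus field_simps)
      finally have "ennreal_powr (\<integral>\<^sup>+z\<in>cube k. ennreal (\<Prod>i=1..m. \<bar>f i z\<bar> powr p) \<partial>\<mu>) (q / p) \<le>
          ennreal_powr (ennreal (P * D * Q)) (q / p)"
        using p q by (intro ennreal_powr_mono) auto
      also have "\<dots> = ennreal ((P * D) powr (q / p) * Q powr (q / p))"
        using P D Q by (simp add: ennreal_powr_ennreal powr_mult)
      \<comment> \<open>The exponents combine to \<open>(p / s) * (q / p) = r\<close>, so
        \<open>p\<close> disappears.\<close>
      also have "Q powr (q / p) = (\<Prod>i=1..m. A k i powr r)"
        unfolding Q_def using p by (subst prod_powr_eq) (auto simp: powr_powr r_def)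
      finally show ?thesis unfolding P'_def .
    qed
    \<comment> \<open>The part that does not depend on the cube. The factor singled out for the
      summation has index 1, which exists since \<open>1 \<le> m\<close>.\<close>
    define G where "G = (\<Prod>i\<in>{1..m} - {1}. J i powr r) * J 1 powr (r - 1)"
    have G: "0 \<le> G" unfolding G_def by (intro mult_nonneg_nonneg prod_nonneg) auto
    have one: "1 \<in> {1..m}" using m by simp
    have prod_bound: "(\<Prod>i=1..m. A k i powr r) \<le> G * A k 1" for k
    proof -
      have "(\<Prod>i=1..m. A k i powr r) = A k 1 powr r * (\<Prod>i\<in>{1..m} - {1}. A k i powr r)"
        using one by (intro prod.remove) auto
      also have "\<dots> \<le> (J 1 powr (r - 1) * A k 1) * (\<Prod>i\<in>{1..m} - {1}. J i powr r)"
        using A(2) A_nonneg r one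
        by (intro mult_mono powr_le_powr_minus_one_mult prod_mono prod_nonneg conjI powr_mono2 mult_nonneg_nonneg) auto
      finally show ?thesis by (simp add: G_def mult_ac)
    qed
    have G_eq: "G * J 1 = (\<Prod>i=1..m. J i powr r)"
    proof -
      have "(\<Prod>i=1..m. J i powr r) = J 1 powr r * (\<Prod>i\<in>{1..m} - {1}. J i powr r)"
        using one by (intro prod.remove) auto
      moreover have "J 1 powr r = J 1 powr (r - 1) * J 1"
        using J[OF one] powr_mult_base[of "J 1" "r - 1"] by (simp add: mult.commute)
      ultimately show ?thesis by (simp add: G_def)
    qed
    have meas: "(\<lambda>z. ?g 1 z * indicator upper_half_space z) \<in> borel_measurable borel"
      using s harmonic_on_continuous(1)[OF harm[OF one]]
      by (intro borel_measurable_ennreal_indicator continuous_on_mult continuous_on_powr' continuous_intros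
          borel_open open_upper_half_space) (auto simp: upper_half_space_def)
    have "(\<Sum>k. ennreal_powr (\<integral>\<^sup>+z\<in>cube k. ennreal (\<Prod>i=1..m. \<bar>f i z\<bar> powr p) \<partial>\<mu>) (q / p)) \<le>
        (\<Sum>k. ennreal (P' * G) * (\<integral>\<^sup>+z\<in>enlarged k. ?g 1 z \<partial>lborel))"
    proof (intro suminf_le summableI)
      fix k
      have "ennreal_powr (\<integral>\<^sup>+z\<in>cube k. ennreal (\<Prod>i=1..m. \<bar>f i z\<bar> powr p) \<partial>\<mu>) (q / p) \<le>
          ennreal (P' * (G * A k 1))"
        using term_bound[of k] prod_bound[of k] P' by (meson ennreal_leI less_imp_le mult_left_mono order_trans)
      also have "\<dots> = ennreal (P' * G) * ennreal (A k 1)"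
        using P' G A_nonneg by (simp add: ennreal_mult[symmetric] mult.assoc)
      finally show "ennreal_powr (\<integral>\<^sup>+z\<in>cube k. ennreal (\<Prod>i=1..m. \<bar>f i z\<bar> powr p) \<partial>\<mu>) (q / p) \<le>
          ennreal (P' * G) * (\<integral>\<^sup>+z\<in>enlarged k. ?g 1 z \<partial>lborel)"
        unfolding A(1)[OF one] .
    qed
    also have "\<dots> = ennreal (P' * G) * (\<Sum>k. \<integral>\<^sup>+z\<in>enlarged k. ?g 1 z \<partial>lborel)"
      by (rule ennreal_suminf_cmult)
    also have "\<dots> \<le> ennreal (P' * G) * (ennreal C0 * ennreal (J 1))"
      using overlap[OF meas] unfolding J_int[OF one] by (intro mult_left_mono) auto
    also have "\<dots> = ennreal (P' * C0 * (\<Prod>i=1..m. J i powr r))"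
      using P' G C0 J[OF one] unfolding G_eq[symmetric] by (simp add: ennreal_mult[symmetric] mult_ac)
    finally have "mixed_norm cube p q m \<mu> f \<le> ennreal_powr (ennreal (P' * C0 * (\<Prod>i=1..m. J i powr r))) (1 / q)"
      unfolding mixed_norm_def using q by (intro ennreal_powr_mono) auto
    also have "\<dots> = ennreal ((P' * C0 * (\<Prod>i=1..m. J i powr r)) powr (1 / q))"
      using P' C0 by (intro ennreal_powr_ennreal mult_nonneg_nonneg prod_nonneg) auto
    also have "(P' * C0 * (\<Prod>i=1..m. J i powr r)) powr (1 / q) = C * (\<Prod>i=1..m. J i powr r) powr (1 / q)"
      unfolding C_def using P' C0 by (intro powr_mult)
    \<comment> \<open>Taking the \<open>q\<close>-th root turns the exponent \<open>r\<close> into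
      \<open>1 / s\<close>, the exponent in the Bergman norms.\<close>
    also have "(\<Prod>i=1..m. J i powr r) powr (1 / q) = (\<Prod>i=1..m. J i powr (1 / s))"
      using q by (subst prod_powr_eq) (auto simp: powr_powr r_def)
    also have "ennreal (C * (\<Prod>i=1..m. J i powr (1 / s))) = ennreal C * ennreal (\<Prod>i=1..m. J i powr (1 / s))"
      using \<open>0 < C\<close> by (intro ennreal_mult prod_nonneg) auto
    also have "ennreal (\<Prod>i=1..m. J i powr (1 / s)) = (\<Prod>i=1..m. bergman_norm s (\<beta> i) (f i))"
      using J_norm by (simp add: prod_ennreal[symmetric])
    finally show "mixed_norm cube p q m \<mu> f \<le> ennreal C * (\<Prod>i=1..m. bergman_norm s (\<beta> i) (f i))" .
  qed
qed

end

theorem theorem2: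
  fixes p q s :: real
    and m :: nat
    and \<beta> :: "nat \<Rightarrow> real"
    and \<mu> :: "((real^'n) \<times> real) measure"
    and \<Delta> :: "nat \<Rightarrow> ((real^'n) \<times> real) set"
    and \<xi> :: "nat \<Rightarrow> real^'n"
    and \<eta> :: "nat \<Rightarrow> real"
  assumes "whitney_decomposition \<Delta> (\<lambda>k. (\<xi> k, \<eta> k))"
    and "0 < p" and "0 < q" and "0 < s" and "s \<le> q"
    and "1 \<le> m"
    and "\<And>i. i \<in> {1..m} \<Longrightarrow> -1 < \<beta> i"
    and "sets \<mu> = sets (restrict_space borel upper_half_space)"
  shows "(\<exists>C>0. \<forall>f. (\<forall>i\<in>{1..m}. f i \<in> bergman_space s (\<beta> i)) \<longrightarrow>
            mixed_norm \<Delta> p q m \<mu> f \<le> ennreal C * (\<Prod>i=1..m. bergman_norm s (\<beta> i) (f i)))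
     \<longleftrightarrow> (\<exists>C>0. \<forall>k. emeasure \<mu> (\<Delta> k) \<le>
            ennreal (C * \<eta> k powr (\<Sum>i=1..m. p * (real CARD('n) + 1 + \<beta> i) / s)))"
proof -
  obtain l a b where W: "whitney_cubes \<xi> \<eta> l a b" and \<Delta>: "\<And>k. \<Delta> k = closed_cube (\<xi> k, \<eta> k) (l k)"
    using whitney_decomposition_cubes[OF assms(1)] by blast
  interpret whitney_cubes \<xi> \<eta> l a b by (rule W)
  have cube: "\<Delta> = cube"
    by (simp add: fun_eq_iff \<Delta> cube_def)
  have \<beta>: "\<forall>i\<in>{1..m}. -1 < \<beta> i"
    using assms(7) by blast
  show ?thesis
    unfolding cube
  proof
    assume "\<exists>C>0. \<forall>f. (\<forall>i\<in>{1..m}. f i \<in> bergman_space s (\<beta> i)) \<longrightarrow>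
            mixed_norm cube p q m \<mu> f \<le> ennreal C * (\<Prod>i=1..m. bergman_norm s (\<beta> i) (f i))"
    then obtain C where "0 < C" and "\<forall>f. (\<forall>i\<in>{1..m}. f i \<in> bergman_space s (\<beta> i)) \<longrightarrow>
            mixed_norm cube p q m \<mu> f \<le> ennreal C * (\<Prod>i=1..m. bergman_norm s (\<beta> i) (f i))"
      by blast
    then show "\<exists>C>0. \<forall>k. emeasure \<mu> (cube k) \<le>
            ennreal (C * \<eta> k powr (\<Sum>i=1..m. p * (real CARD('n) + 1 + \<beta> i) / s))"
      by (rule embedding_imp_measure_bound[OF assms(2-4) \<beta> assms(8)])
  next
    assume "\<exists>C>0. \<forall>k. emeasure \<mu> (cube k) \<le>
            ennreal (C * \<eta> k powr (\<Sum>i=1..m. p * (real CARD('n) + 1 + \<beta> i) / s))"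
    then obtain D where "0 < D" and "\<And>k. emeasure \<mu> (cube k) \<le>
            ennreal (D * \<eta> k powr (\<Sum>i=1..m. p * (real CARD('n) + 1 + \<beta> i) / s))"
      by blast
    then show "\<exists>C>0. \<forall>f. (\<forall>i\<in>{1..m}. f i \<in> bergman_space s (\<beta> i)) \<longrightarrow>
            mixed_norm cube p q m \<mu> f \<le> ennreal C * (\<Prod>i=1..m. bergman_norm s (\<beta> i) (f i))"
      by (rule measure_bound_imp_embedding[OF assms(2-6,8)])
  qed
qed

end
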